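(* Let $\phi\colon \mathbb{D}\to\mathbb{D}$ be an analytic self-map of the open unit disk. Then there exists $w\in H^2$ with $w\not\equiv 0$ such that the weighted composition operator $M_wC_\phi\colon f\mapsto w\,(f\circ\phi)$ is a bounded and compact operator on $H^2$ if and only if $$m\big(\{\xi\in\mathbb{T} : |\phi^\ast(\xi)|=1\}\big)=0 .$$
   Context: $\mathbb{D}$ is the open unit disk, $\mathbb{T}=\partial\mathbb{D}$, and $m$ is the normalized Lebesgue (Haar) measure on $\mathbb{T}$. $H^2$ is the Hardy space of the disk. For an analytic self-map $\phi$ of $\mathbb{D}$, $\phi^\ast(\xi)=\lim_{r\to1^-}\phi(r\xi)$ denotes its radial limit function, defined $m$-almost everywhere. For $w\in H^2$, $M_wC_\phi$ is the operator $f\mapsto w\,(f\circ\phi)$. *)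

theory Defs
  imports "HOL-Analysis.Analysis"
begin

definition h2_mean :: "(complex \<Rightarrow> complex) \<Rightarrow> real \<Rightarrow> real" where
  "h2_mean f r = (1 / (2 * pi)) * (LINT t:{0..2*pi}|lborel. (cmod (f (of_real r * cis t)))\<^sup>2)"

text \<open>The Hardy space H^2 of the unit disk (functions are only relevant on the disk).\<close>
definition H2 :: "(complex \<Rightarrow> complex) set" where
  "H2 = {f. f holomorphic_on ball 0 1 \<and> bdd_above (h2_mean f ` {0..<1})}"

definition h2_norm :: "(complex \<Rightarrow> complex) \<Rightarrow> real" where
  "h2_norm f = sqrt (SUP r\<in>{0..<1}. h2_mean f r)"

definition bounded_on_H2 :: "((complex \<Rightarrow> complex) \<Rightarrow> (complex \<Rightarrow> complex)) \<Rightarrow> bool" where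
  "bounded_on_H2 T \<longleftrightarrow> (\<forall>f\<in>H2. T f \<in> H2) \<and> (\<exists>C. \<forall>f\<in>H2. h2_norm (T f) \<le> C * h2_norm f)"

definition compact_on_H2 :: "((complex \<Rightarrow> complex) \<Rightarrow> (complex \<Rightarrow> complex)) \<Rightarrow> bool" where
  "compact_on_H2 T \<longleftrightarrow> (\<forall>f :: nat \<Rightarrow> complex \<Rightarrow> complex.
      (\<forall>n. f n \<in> H2 \<and> h2_norm (f n) \<le> 1) \<longrightarrow>
      (\<exists>\<sigma> g. strict_mono \<sigma> \<and> g \<in> H2 \<and>
          (\<lambda>n. h2_norm (\<lambda>z. T (f (\<sigma> n)) z - g z)) \<longlonglongrightarrow> 0))"

definition wcomp :: "(complex \<Rightarrow> complex) \<Rightarrow> (complex \<Rightarrow> complex) \<Rightarrow> (complex \<Rightarrow> complex) \<Rightarrow> (complex \<Rightarrow> complex)" where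
  "wcomp w \<phi> f = (\<lambda>z. w z * f (\<phi> z))"

definition radial_unimodular :: "(complex \<Rightarrow> complex) \<Rightarrow> real \<Rightarrow> bool" where
  "radial_unimodular \<phi> t \<longleftrightarrow>
     (\<exists>L. cmod L = 1 \<and> ((\<lambda>r::real. \<phi> (of_real r * cis t)) \<longlongrightarrow> L) (at_left 1))"

end

theory Submission
  imports Defs "HOL-Complex_Analysis.Complex_Analysis"
begin

text \<open>
  Both sides are equivalent to the vanishing of the infimum over \<open>k\<close> of the \<open>H\<^sup>2\<close> norms of \<open>\<phi>\<^sup>k\<close>.
  This condition follows from the boundary condition by Fatou's theorem on radial limits and
  dominated convergence, and implies it by Fatou's lemma.

  The tool for the rest is an explicit harmonic majorant: for a polynomial \<open>p\<close> there is a polynomial \<open>q\<close>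
  with \<open>\<bar>p\<bar>\<^sup>2 \<le> Re q\<close> on the disk and equality on the circle.  If the infimum is zero, pick \<open>k\<^sub>j\<close> with
  summable squared norms and let \<open>w = exp (- \<Sum>\<^sub>j q\<^sub>j)\<close> where \<open>Re q\<^sub>j\<close> majorizes the square of the modulus
  of \<open>\<phi>\<close> to the power \<open>k\<^sub>j\<close>.  Then \<open>w\<close> is bounded, nonzero, and tends to \<open>0\<close> where \<open>\<bar>\<phi>\<bar>\<close> tends to \<open>1\<close>, so the operator
  is compact because \<open>f \<mapsto> f \<circ> \<phi>\<close> is bounded.  Conversely, compactness forces \<open>w \<phi>\<^sup>k \<rightarrow> 0\<close> in \<open>H\<^sup>2\<close> along a
  subsequence; evaluating \<open>w exp (K q / 2)\<close> at a point, with \<open>Re q\<close> majorizing \<open>\<bar>\<phi>\<^sup>k\<bar>\<^sup>2\<close>, bounds \<open>\<bar>w\<bar>\<^sup>2\<close> there by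
  a multiple of \<open>exp (- c K)\<close> for every \<open>K\<close> unless the infimum is zero.
\<close>

section \<open>Circle means and polynomial harmonic majorants\<close>

text \<open>The squared norms of the powers of \<open>\<phi>\<close> decrease to the measure of the
  set where the radial limit is unimodular, so their infimum tests that set without naming it. With
  boundary functions for H^2 at hand, compactness would make w vanish on that set and a uniqueness
  theorem would give w = 0; conversely, an outer function of small modulus near that set would serve
  as weight. The estimates below avoid such boundary functions: they are made for dilations f (s z),
  s < 1, which are holomorphic past the circle and uniform limits of polynomials there. The
  exponentials stand in for the two classical tools. On the circle exp (K q / 2) is large only where
  |\<phi>^k| is near 1, where w must be small in mean, while Harnack keeps Re q at the chosen point
  proportional to its mean: a quantitative uniqueness theorem. And exp (- sum of q_j) is the outer
  function: minus the logarithm of its modulus at 0 is a sum of circle means, so summability keeps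
  the weight from collapsing to 0.\<close>

definition circle_mean :: "(complex \<Rightarrow> 'a::banach) \<Rightarrow> 'a" where
  "circle_mean g = (1 / (2 * pi)) *\<^sub>R integral {0..2*pi} (\<lambda>t. g (cis t))"

lemma continuous_on_circle_cis:
  "continuous_on (sphere 0 1) g \<Longrightarrow> continuous_on S (\<lambda>t. g (cis t))"
  by (rule continuous_on_compose2[of "sphere 0 1" g]) (auto intro!: continuous_intros)

lemma integrable_circle_cis:
  fixes g :: "complex \<Rightarrow> 'a::banach"
  shows "continuous_on (sphere 0 1) g \<Longrightarrow> (\<lambda>t. g (cis t)) integrable_on {a..b::real}"
  by (intro integrable_continuous_real continuous_on_circle_cis)

lemma circle_mean_const [simp]: "circle_mean (\<lambda>z. c) = c"
  by (simp add: circle_mean_def)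

lemma circle_mean_add:
  assumes "continuous_on (sphere 0 1) f" "continuous_on (sphere 0 1) g"
  shows "circle_mean (\<lambda>z. f z + g z) = circle_mean f + circle_mean g"
  using assms by (simp add: circle_mean_def integral_add integrable_circle_cis scaleR_add_right)

lemma circle_mean_diff:
  assumes "continuous_on (sphere 0 1) f" "continuous_on (sphere 0 1) g"
  shows "circle_mean (\<lambda>z. f z - g z) = circle_mean f - circle_mean g"
  using assms by (simp add: circle_mean_def integral_diff integrable_circle_cis scaleR_diff_right)

lemma circle_mean_bounded_linear:
  assumes "bounded_linear h" "continuous_on (sphere 0 1) f"
  shows "circle_mean (\<lambda>z. h (f z)) = h (circle_mean f)"
  using integral_linear[OF integrable_circle_cis[OF assms(2)] assms(1), of 0 "2*pi"]
  by (simp add: circle_mean_def o_def linear_scale[OF bounded_linear.linear[OF assms(1)]])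

lemma circle_mean_mult_left:
  fixes c :: "'a::{banach, real_normed_algebra}"
  assumes "continuous_on (sphere 0 1) f"
  shows "circle_mean (\<lambda>z. c * f z) = c * circle_mean f"
  by (rule circle_mean_bounded_linear[OF bounded_linear_mult_right assms])

lemma circle_mean_mono:
  fixes f g :: "complex \<Rightarrow> real"
  assumes "continuous_on (sphere 0 1) f" "continuous_on (sphere 0 1) g"
    and "\<And>z. cmod z = 1 \<Longrightarrow> f z \<le> g z"
  shows "circle_mean f \<le> circle_mean g"
  unfolding circle_mean_def
  by (intro scaleR_left_mono integral_le integrable_circle_cis assms) auto

lemma circle_mean_cong:
  "(\<And>z. cmod z = 1 \<Longrightarrow> f z = g z) \<Longrightarrow> circle_mean f = circle_mean g"
  by (simp add: circle_mean_def)

lemma circle_mean_tendsto: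
  fixes f :: "'b \<Rightarrow> complex \<Rightarrow> 'a::banach"
  assumes "uniform_limit (sphere 0 1) f g F" "F \<noteq> bot"
    and "\<And>n. continuous_on (sphere 0 1) (f n)"
  shows "((\<lambda>n. circle_mean (f n)) \<longlongrightarrow> circle_mean g) F"
proof -
  have "uniform_limit {0..2*pi} (\<lambda>n t. f n (cis t)) (\<lambda>t. g (cis t)) F"
    using uniform_limit_compose'[OF assms(1), of cis "{0..2*pi}"] by auto
  then obtain I J where IJ: "\<And>n. ((\<lambda>t. f n (cis t)) has_integral I n) {0..2*pi}"
    "((\<lambda>t. g (cis t)) has_integral J) {0..2*pi}" "(I \<longlongrightarrow> J) F"
    by (rule uniform_limit_integral) (use assms(2) in \<open>auto intro: continuous_on_circle_cis assms(3)\<close>)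
  then show ?thesis
    unfolding circle_mean_def using integral_unique[OF IJ(1)] integral_unique[OF IJ(2)]
    by (auto intro!: tendsto_intros)
qed

text \<open>Cauchy's formula at the centre: along the unit circle the derivative
  \<open>\<i> * cis t\<close> of the path cancels the denominator up to \<open>\<i>\<close>, which
  leaves a plain average.\<close>

lemma circle_mean_holomorphic:
  assumes "continuous_on (cball 0 1) h" "h holomorphic_on ball 0 1"
  shows "circle_mean h = h 0"
proof -
  have "((\<lambda>u. h u / (u - 0)) has_contour_integral (2 * of_real pi * \<i> * h 0)) (circlepath 0 1)"
    by (rule Cauchy_integral_circlepath) (use assms in auto)
  then have *: "((\<lambda>t. \<i> * h (cis t)) has_integral (2 * of_real pi * \<i> * h 0)) {0..2*pi}"
    unfolding circlepath_def using has_contour_integral_part_circlepath_iff[of 0 "2*pi"]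
    by (simp add: mult.commute)
  have eq1: "- \<i> * (\<i> * x) = x" for x by (simp flip: mult.assoc)
  have eq2: "- \<i> * (2 * of_real pi * \<i> * h 0) = 2 * of_real pi * h 0" by (simp add: algebra_simps)
  from has_integral_mult_right[OF *, of "- \<i>"]
  have "((\<lambda>t. h (cis t)) has_integral (2 * of_real pi * h 0)) {0..2*pi}"
    by (simp only: eq1 eq2)
  then show ?thesis
    by (simp add: circle_mean_def integral_unique scaleR_conv_of_real)
qed

lemma circle_mean_Re_holomorphic:
  assumes "continuous_on (cball 0 1) h" "h holomorphic_on ball 0 1"
  shows "circle_mean (\<lambda>z. Re (h z)) = Re (h 0)"
  using circle_mean_bounded_linear[OF bounded_linear_Re, of h] circle_mean_holomorphic[OF assms]
    continuous_on_subset[OF assms(1)] by (simp add: sphere_cball)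

lemma h2_mean_eq_circle_mean:
  assumes "continuous_on (sphere 0 1) (\<lambda>z. f (of_real r * z))"
  shows "h2_mean f r = circle_mean (\<lambda>z. (cmod (f (of_real r * z)))\<^sup>2)"
proof -
  have "continuous_on (sphere 0 1) (\<lambda>z. (cmod (f (of_real r * z)))\<^sup>2)"
    by (intro continuous_intros assms)
  then have "set_integrable lborel {0..2*pi} (\<lambda>t. (cmod (f (of_real r * cis t)))\<^sup>2)"
    by (intro borel_integrable_atLeastAtMost') (rule continuous_on_circle_cis)
  then show ?thesis
    by (simp add: h2_mean_def circle_mean_def set_borel_integral_eq_integral(2))
qed

lemma h2_mean_nonneg: "0 \<le> h2_mean f r"
  unfolding h2_mean_def set_lebesgue_integral_def by (intro mult_nonneg_nonneg integral_nonneg_AE) auto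

text \<open>On the circle, \<open>\<bar>a + z p z\<bar>\<^sup>2 = \<bar>a\<bar>\<^sup>2 + 2 Re (cnj a * z * p z) + \<bar>p z\<bar>\<^sup>2\<close>;
  inside the disk the right hand side exceeds the left one by \<open>(1 - \<bar>z\<bar>\<^sup>2) \<bar>p z\<bar>\<^sup>2\<close>.\<close>

lemma poly_square_harmonic_majorant:
  fixes p :: "complex poly"
  obtains q where "\<And>z. cmod z \<le> 1 \<Longrightarrow> (cmod (poly p z))\<^sup>2 \<le> Re (poly q z)"
    and "\<And>z. cmod z = 1 \<Longrightarrow> Re (poly q z) = (cmod (poly p z))\<^sup>2"
proof -
  have "\<exists>q. (\<forall>z. cmod z \<le> 1 \<longrightarrow> (cmod (poly p z))\<^sup>2 \<le> Re (poly q z)) \<and>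
            (\<forall>z. cmod z = 1 \<longrightarrow> Re (poly q z) = (cmod (poly p z))\<^sup>2)"
  proof (induction p)
    case 0
    show ?case by (rule exI[of _ 0]) auto
  next
    case (pCons a p)
    then obtain q where q: "\<And>z. cmod z \<le> 1 \<Longrightarrow> (cmod (poly p z))\<^sup>2 \<le> Re (poly q z)"
      "\<And>z. cmod z = 1 \<Longrightarrow> Re (poly q z) = (cmod (poly p z))\<^sup>2" by blast
    define q' where "q' = [:of_real ((cmod a)\<^sup>2):] + smult (2 * cnj a) (pCons 0 p) + q"
    have expand: "Re (poly q' z) - (cmod (poly (pCons a p) z))\<^sup>2
        = Re (poly q z) - (cmod z)\<^sup>2 * (cmod (poly p z))\<^sup>2" for z
    proof -
      have "(cmod (a + z * poly p z))\<^sup>2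
          = (cmod a)\<^sup>2 + 2 * Re (cnj a * (z * poly p z)) + (cmod (z * poly p z))\<^sup>2"
        by (simp only: cmod_power2 plus_complex.sel times_complex.sel cnj.sel) algebra
      then show ?thesis by (simp add: q'_def norm_mult power_mult_distrib algebra_simps)
    qed
    show ?case
    proof (intro exI[of _ q'] conjI allI impI)
      fix z :: complex assume z: "cmod z \<le> 1"
      have "(cmod z)\<^sup>2 * (cmod (poly p z))\<^sup>2 \<le> 1 * (cmod (poly p z))\<^sup>2"
        by (intro mult_right_mono) (use z in \<open>auto simp: power_le_one\<close>)
      then show "(cmod (poly (pCons a p) z))\<^sup>2 \<le> Re (poly q' z)"
        using expand[of z] q(1)[OF z] by linarith
    next
      fix z :: complex assume "cmod z = 1"
      then show "Re (poly q' z) = (cmod (poly (pCons a p) z))\<^sup>2"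
        using expand[of z] q(2)[of z] by simp
    qed
  qed
  then show thesis using that by blast
qed

lemma holomorphic_poly_approx:
  assumes "f holomorphic_on ball 0 R" "1 < R" "e > 0"
  obtains p :: "complex poly" where "\<And>z. cmod z \<le> 1 \<Longrightarrow> cmod (poly p z - f z) < e"
proof -
  define a where "a n = (deriv ^^ n) f 0 / fact n" for n
  have sums: "(\<lambda>n. a n * z ^ n) sums f z" if "cmod z < R" for z
    using holomorphic_power_series[OF assms(1), of z] that by (simp add: a_def)
  obtain x where x: "1 < x" "x < R" using \<open>1 < R\<close> dense by blast
  have "summable (\<lambda>n. cmod (a n * 1 ^ n))"
    \<comment> \<open>Convergence at a point x beyond 1 gives absolute summability of the
      coefficients, which then serve as the bounds of the M-test on the closed disk.\<close>
    by (rule powser_insidea[of a "of_real x"]) (use sums[of "of_real x"] x in \<open>auto simp: sums_iff\<close>)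
  then have "uniform_limit (cball 0 1) (\<lambda>n z. \<Sum>i<n. a i * z ^ i) (\<lambda>z. suminf (\<lambda>i. a i * z ^ i)) sequentially"
    by (intro Weierstrass_m_test[where M="\<lambda>n. cmod (a n)"])
       (auto simp: norm_mult norm_power intro!: mult_right_le_one_le power_le_one)
  from uniform_limitD[OF this \<open>e > 0\<close>] obtain n where
    "\<forall>z\<in>cball 0 1. dist (\<Sum>i<n. a i * z ^ i) (suminf (\<lambda>i. a i * z ^ i)) < e"
    by (auto simp: eventually_sequentially)
  then have n: "\<And>z. cmod z \<le> 1 \<Longrightarrow> dist (\<Sum>i<n. a i * z ^ i) (suminf (\<lambda>i. a i * z ^ i)) < e"
    by simp
  show thesis
  proof (rule that[of "\<Sum>i<n. monom (a i) i"])
    fix z :: complex assume z: "cmod z \<le> 1"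
    have "suminf (\<lambda>i. a i * z ^ i) = f z"
      using sums[of z] z assms(2) by (simp add: sums_iff)
    then show "cmod (poly (\<Sum>i<n. monom (a i) i) z - f z) < e"
      using n[OF z] by (simp add: poly_sum poly_monom dist_norm)
  qed
qed

lemma cmod_square_diff_le:
  "\<bar>(cmod a)\<^sup>2 - (cmod b)\<^sup>2\<bar> \<le> cmod (a - b) * (2 * cmod b + cmod (a - b))"
proof -
  have "\<bar>(cmod a)\<^sup>2 - (cmod b)\<^sup>2\<bar> = \<bar>cmod a - cmod b\<bar> * (cmod a + cmod b)"
    by (simp add: power2_eq_square square_diff_square_factored abs_mult mult.commute)
  also have "\<dots> \<le> cmod (a - b) * (2 * cmod b + cmod (a - b))"
    by (intro mult_mono norm_triangle_ineq3) (use norm_triangle_sub[of a b] in auto)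
  finally show ?thesis .
qed

text \<open>The exact majorant of an approximating polynomial, raised by e / 2: half of e restores
  the domination of |f|^2, and the other half is the approximation error on the circle.\<close>

lemma holomorphic_square_poly_majorant:
  assumes f: "f holomorphic_on ball 0 R" "1 < R" and "e > 0"
  obtains q :: "complex poly" where "\<And>z. cmod z \<le> 1 \<Longrightarrow> (cmod (f z))\<^sup>2 \<le> Re (poly q z)"
    and "\<And>z. cmod z = 1 \<Longrightarrow> Re (poly q z) \<le> (cmod (f z))\<^sup>2 + e"
proof -
  have "continuous_on (cball 0 1) f"
    by (rule holomorphic_on_imp_continuous_on, rule holomorphic_on_subset[OF f(1)]) (use f(2) in auto)
  then have "bounded (f ` cball 0 1)"
    by (intro compact_imp_bounded compact_continuous_image) auto
  then obtain B where "\<forall>z\<in>cball 0 1. cmod (f z) \<le> B"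
    by (auto simp: bounded_iff)
  then have B: "\<And>z. cmod z \<le> 1 \<Longrightarrow> cmod (f z) \<le> B" by simp
  have "B \<ge> 0" using order_trans[OF norm_ge_zero B[of 0]] by simp
  define c where "c = 2 * B + 1"
  have c: "0 < c" using \<open>B \<ge> 0\<close> by (simp add: c_def)
  \<comment> \<open>The squares differ by at most d (2 B + d). The cap d \<le> 1 turns this into d
    (2 B + 1), and the second entry makes that at most e / 2.\<close>
  define d where "d = min 1 (e / 2 / c)"
  have d: "0 < d" "d \<le> 1" "d * (2 * B + 1) \<le> e / 2"
  proof -
    have "d * c \<le> e / 2 / c * c"
      using c by (intro mult_right_mono) (auto simp: d_def)
    then show "d * (2 * B + 1) \<le> e / 2" using c by (simp add: c_def[symmetric])
  qed (use c \<open>e > 0\<close> in \<open>auto simp: d_def\<close>)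
  obtain p where p: "\<And>z. cmod z \<le> 1 \<Longrightarrow> cmod (poly p z - f z) < d"
    using holomorphic_poly_approx[OF f d(1)] by blast
  have close: "\<bar>(cmod (poly p z))\<^sup>2 - (cmod (f z))\<^sup>2\<bar> \<le> e / 2" if z: "cmod z \<le> 1" for z
  proof -
    have "cmod (poly p z - f z) * (2 * cmod (f z) + cmod (poly p z - f z)) \<le> d * (2 * B + 1)"
      using p[OF z] B[OF z] d by (intro mult_mono) auto
    then show ?thesis using cmod_square_diff_le[of "poly p z" "f z"] d(3) by linarith
  qed
  obtain q where q: "\<And>z. cmod z \<le> 1 \<Longrightarrow> (cmod (poly p z))\<^sup>2 \<le> Re (poly q z)"
    "\<And>z. cmod z = 1 \<Longrightarrow> Re (poly q z) = (cmod (poly p z))\<^sup>2"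
    using poly_square_harmonic_majorant by blast
  show thesis
  proof (rule that[of "q + [:of_real (e / 2):]"])
    show "(cmod (f z))\<^sup>2 \<le> Re (poly (q + [:of_real (e / 2):]) z)" if "cmod z \<le> 1" for z
      using close[OF that] q(1)[OF that] unfolding abs_le_iff by simp
    show "Re (poly (q + [:of_real (e / 2):]) z) \<le> (cmod (f z))\<^sup>2 + e" if "cmod z = 1" for z
      using close[of z] q(2)[OF that] that unfolding abs_le_iff by simp
  qed
qed

section \<open>Poisson formula and subordination\<close>

definition poisson_kernel :: "complex \<Rightarrow> complex \<Rightarrow> real" where
  "poisson_kernel z \<zeta> = (1 - (cmod z)\<^sup>2) / (cmod (\<zeta> - z))\<^sup>2"

lemma continuous_on_poisson_kernel:
  assumes "cmod z < 1"
  shows "continuous_on (sphere 0 1) (poisson_kernel z)"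
  unfolding poisson_kernel_def[abs_def]
  by (intro continuous_intros) (use assms in auto)

lemma cnj_mult_self_circle: "cmod \<zeta> = 1 \<Longrightarrow> \<zeta> * cnj \<zeta> = 1"
  by (simp add: complex_norm_square[symmetric])

lemma one_minus_cnj_mult_nonzero:
  assumes "cmod z < 1" "cmod \<zeta> \<le> 1"
  shows "1 - cnj z * \<zeta> \<noteq> 0"
proof
  assume "1 - cnj z * \<zeta> = 0"
  then have "cmod (cnj z * \<zeta>) = 1" by simp
  moreover have "cmod z * cmod \<zeta> \<le> cmod z * 1" using assms by (intro mult_left_mono) auto
  ultimately show False using assms by (simp add: norm_mult)
qed

text \<open>On the circle \<open>cnj \<zeta>\<close> is the inverse of \<zeta>, so multiplying by
  \<zeta> - z turns the kernel into the boundary value of a function holomorphic in \<zeta> that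
  vanishes at 0. This drives the induction for the Poisson formula.\<close>

lemma poisson_kernel_mult:
  assumes "cmod z < 1" "cmod \<zeta> = 1"
  shows "of_real (poisson_kernel z \<zeta>) * (\<zeta> - z) = of_real (1 - (cmod z)\<^sup>2) * \<zeta> / (1 - cnj z * \<zeta>)"
proof -
  have "\<zeta> \<noteq> z" using assms by auto
  have eq: "of_real ((cmod (\<zeta> - z))\<^sup>2) * \<zeta> = (\<zeta> - z) * (1 - cnj z * \<zeta>)"
  proof -
    have "of_real ((cmod (\<zeta> - z))\<^sup>2) * \<zeta> = (\<zeta> - z) * (\<zeta> * cnj \<zeta> - cnj z * \<zeta>)"
      unfolding complex_norm_square by (simp add: algebra_simps)
    then show ?thesis using cnj_mult_self_circle[OF assms(2)] by simp
  qed
  show ?thesis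
    using one_minus_cnj_mult_nonzero[of z \<zeta>] assms \<open>\<zeta> \<noteq> z\<close> eq
    by (simp add: poisson_kernel_def divide_simps) (simp add: algebra_simps)
qed

text \<open>The Herglotz form, holomorphic in the boundary variable \<zeta> rather than in z: the
  mean of the kernel can then be read off at \<zeta> = 0.\<close>

lemma poisson_kernel_eq_Re:
  assumes "cmod z < 1" "cmod \<zeta> = 1"
  shows "poisson_kernel z \<zeta> = Re ((1 + cnj z * \<zeta>) / (1 - cnj z * \<zeta>))"
proof -
  have "\<zeta> * cnj (1 - cnj z * \<zeta>) = \<zeta> - z * (\<zeta> * cnj \<zeta>)" by (simp add: algebra_simps)
  then have "cmod (\<zeta> - z) = cmod (\<zeta> * cnj (1 - cnj z * \<zeta>))"
    using cnj_mult_self_circle[OF assms(2)] by simp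
  also have "\<dots> = cmod (1 - cnj z * \<zeta>)"
    using assms(2) by (simp only: norm_mult complex_mod_cnj)
  finally have *: "cmod (\<zeta> - z) = cmod (1 - cnj z * \<zeta>)" .
  have "Re ((1 + u) / (1 - u)) = (1 - (cmod u)\<^sup>2) / (cmod (1 - u))\<^sup>2" for u
    by (simp add: Re_divide cmod_power2) (simp add: power2_eq_square algebra_simps)
  then show ?thesis
    using assms by (simp add: poisson_kernel_def * norm_mult)
qed

lemma circle_mean_poisson_kernel:
  assumes "cmod z < 1"
  shows "circle_mean (poisson_kernel z) = 1"
proof -
  have nz: "\<And>\<zeta>. cmod \<zeta> \<le> 1 \<Longrightarrow> cnj z * \<zeta> \<noteq> 1"
    using one_minus_cnj_mult_nonzero[OF assms] by force
  have "circle_mean (poisson_kernel z) = circle_mean (\<lambda>\<zeta>. Re ((1 + cnj z * \<zeta>) / (1 - cnj z * \<zeta>)))"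
    by (rule circle_mean_cong) (rule poisson_kernel_eq_Re[OF assms])
  also have "\<dots> = Re ((1 + cnj z * 0) / (1 - cnj z * 0))"
    by (rule circle_mean_Re_holomorphic) (auto intro!: continuous_intros holomorphic_intros simp: nz)
  finally show ?thesis by simp
qed

text \<open>Induction on the coefficients. Replacing the factor \<zeta> by the constant z under the
  mean costs the kernel times (\<zeta> - z) q(\<zeta>), which extends to a holomorphic function with
  value 0 at the origin and so has mean zero.\<close>

lemma poisson_formula_poly:
  assumes z: "cmod z < 1"
  shows "circle_mean (\<lambda>\<zeta>. of_real (poisson_kernel z \<zeta>) * poly q \<zeta>) = poly q z"
proof (induction q)
  case 0
  then show ?case by simp
next
  case (pCons a q)
  note cont = continuous_on_poisson_kernel[OF z]
  have nz: "\<And>\<zeta>. cmod \<zeta> \<le> 1 \<Longrightarrow> cnj z * \<zeta> \<noteq> 1"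
    using one_minus_cnj_mult_nonzero[OF z] by force
  define h where "h \<zeta> = of_real (1 - (cmod z)\<^sup>2) * \<zeta> / (1 - cnj z * \<zeta>) * poly q \<zeta>" for \<zeta>
  have h: "continuous_on (cball 0 1) h" "h holomorphic_on ball 0 1"
    unfolding h_def by (auto intro!: continuous_intros holomorphic_intros simp: nz)
  have h': "continuous_on (sphere 0 1) h"
    using continuous_on_subset[OF h(1)] by (simp add: sphere_cball)
  have "circle_mean (\<lambda>\<zeta>. of_real (poisson_kernel z \<zeta>) * poly (pCons a q) \<zeta>)
      = circle_mean (\<lambda>\<zeta>. a * of_real (poisson_kernel z \<zeta>) + (h \<zeta> + z * (of_real (poisson_kernel z \<zeta>) * poly q \<zeta>)))"
  proof (rule circle_mean_cong)
    fix \<zeta> :: complex assume "cmod \<zeta> = 1"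
    then have "h \<zeta> = of_real (poisson_kernel z \<zeta>) * (\<zeta> - z) * poly q \<zeta>"
      unfolding h_def using poisson_kernel_mult[OF z] by metis
    then show "of_real (poisson_kernel z \<zeta>) * poly (pCons a q) \<zeta>
        = a * of_real (poisson_kernel z \<zeta>) + (h \<zeta> + z * (of_real (poisson_kernel z \<zeta>) * poly q \<zeta>))"
      by (simp add: algebra_simps)
  qed
  also have "\<dots> = a * circle_mean (\<lambda>\<zeta>. of_real (poisson_kernel z \<zeta>))
      + (circle_mean h + z * circle_mean (\<lambda>\<zeta>. of_real (poisson_kernel z \<zeta>) * poly q \<zeta>))"
    by (simp add: circle_mean_add circle_mean_mult_left continuous_on_add continuous_on_mult_left
        continuous_on_mult continuous_on_of_real cont h' continuous_on_poly)
  also have "circle_mean (\<lambda>\<zeta>. of_real (poisson_kernel z \<zeta>)) = complex_of_real 1"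
    using circle_mean_bounded_linear[OF bounded_linear_of_real cont] circle_mean_poisson_kernel[OF z] by simp
  also have "circle_mean h = 0"
    using circle_mean_holomorphic[OF h] by (simp add: h_def)
  finally show ?case using pCons by simp
qed

lemma poisson_formula_Re_poly:
  assumes z: "cmod z < 1"
  shows "circle_mean (\<lambda>\<zeta>. poisson_kernel z \<zeta> * Re (poly q \<zeta>)) = Re (poly q z)"
proof -
  have "circle_mean (\<lambda>\<zeta>. Re (of_real (poisson_kernel z \<zeta>) * poly q \<zeta>)) = Re (poly q z)"
    by (subst circle_mean_bounded_linear[OF bounded_linear_Re])
       (auto intro!: continuous_intros continuous_on_poisson_kernel simp: z poisson_formula_poly)
  then show ?thesis by simp
qed

lemma poisson_kernel_bounds:
  assumes "cmod z < 1" "cmod \<zeta> = 1"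
  shows "(1 - cmod z) / (1 + cmod z) \<le> poisson_kernel z \<zeta>"
    and "poisson_kernel z \<zeta> \<le> (1 + cmod z) / (1 - cmod z)"
proof -
  have lo: "1 - cmod z \<le> cmod (\<zeta> - z)" and hi: "cmod (\<zeta> - z) \<le> 1 + cmod z"
    using assms norm_triangle_ineq2[of \<zeta> z] norm_triangle_ineq4[of \<zeta> z] by auto
  have eq: "1 - (cmod z)\<^sup>2 = (1 - cmod z) * (1 + cmod z)" by (simp add: power2_eq_square algebra_simps)
  have pos: "0 < 1 - (cmod z)\<^sup>2" using assms by (simp add: eq add_pos_nonneg)
  have "(1 - cmod z) / (1 + cmod z) = (1 - (cmod z)\<^sup>2) / (1 + cmod z)\<^sup>2"
    using add_pos_nonneg[of 1 "cmod z"] by (simp only: eq) (simp add: power2_eq_square)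
  also have "\<dots> \<le> poisson_kernel z \<zeta>"
    unfolding poisson_kernel_def
    by (intro divide_left_mono power_mono mult_pos_pos zero_less_power) (use lo hi assms pos in auto)
  finally show "(1 - cmod z) / (1 + cmod z) \<le> poisson_kernel z \<zeta>" .
  have "poisson_kernel z \<zeta> \<le> (1 - (cmod z)\<^sup>2) / (1 - cmod z)\<^sup>2"
    unfolding poisson_kernel_def
    by (intro divide_left_mono power_mono mult_pos_pos zero_less_power) (use lo hi assms pos in auto)
  also have "\<dots> = (1 + cmod z) / (1 - cmod z)"
    using assms by (simp only: eq) (simp add: power2_eq_square)
  finally show "poisson_kernel z \<zeta> \<le> (1 + cmod z) / (1 - cmod z)" .
qed

lemma circle_mean_Re_poly: "circle_mean (\<lambda>\<zeta>. Re (poly q \<zeta>)) = Re (poly q 0)"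
  by (rule circle_mean_Re_holomorphic) (auto intro!: continuous_intros holomorphic_intros)

lemma harnack_poly:
  assumes z: "cmod z < 1" and q: "\<And>\<zeta>. cmod \<zeta> = 1 \<Longrightarrow> 0 \<le> Re (poly q \<zeta>)"
  shows "(1 - cmod z) / (1 + cmod z) * Re (poly q 0) \<le> Re (poly q z)"
    and "Re (poly q z) \<le> (1 + cmod z) / (1 - cmod z) * Re (poly q 0)"
proof -
  have mean: "c * Re (poly q 0) = circle_mean (\<lambda>\<zeta>. c * Re (poly q \<zeta>))" for c
    by (subst circle_mean_mult_left) (auto intro!: continuous_intros simp: circle_mean_Re_poly)
  note cont = continuous_on_poisson_kernel[OF z]
  show "(1 - cmod z) / (1 + cmod z) * Re (poly q 0) \<le> Re (poly q z)"
    unfolding mean poisson_formula_Re_poly[OF z, of q, symmetric]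
    by (intro circle_mean_mono continuous_intros cont mult_right_mono poisson_kernel_bounds q z)
  show "Re (poly q z) \<le> (1 + cmod z) / (1 - cmod z) * Re (poly q 0)"
    unfolding mean poisson_formula_Re_poly[OF z, of q, symmetric]
    by (intro circle_mean_mono continuous_intros cont mult_right_mono poisson_kernel_bounds q z)
qed

lemma holomorphic_on_dilate:
  assumes "f holomorphic_on ball 0 1" "0 \<le> s" "s < 1"
  obtains R where "1 < R" "(\<lambda>z. f (of_real s * z)) holomorphic_on ball 0 R"
proof -
  \<comment> \<open>Any R strictly between 1 and 1 / s would do for s > 0; this one also covers s =
    0, and s R = 2 s / (1 + s) < 1.\<close>
  define R where "R = 2 / (1 + s)"
  have "1 < R" using assms by (simp add: R_def)
  moreover have "(\<lambda>z. f (of_real s * z)) holomorphic_on ball 0 R"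
  proof (rule holomorphic_on_compose_gen[OF _ assms(1), unfolded o_def])
    show "(*) (complex_of_real s) holomorphic_on ball 0 R" by (intro holomorphic_intros)
    show "(*) (complex_of_real s) ` ball 0 R \<subseteq> ball 0 1"
    proof clarsimp
      fix x :: complex assume "cmod x < R"
      then have "s * cmod x \<le> s * R" using assms by (intro mult_left_mono) auto
      also have "\<dots> < 1" using assms by (simp add: R_def divide_simps)
      finally show "cmod (of_real s * x) < 1" using assms by (simp add: norm_mult)
    qed
  qed
  ultimately show thesis using that by blast
qed

lemma continuous_on_dilate:
  assumes "f holomorphic_on ball 0 1" "0 \<le> s" "s < 1" "S \<subseteq> cball 0 1"
  shows "continuous_on S (\<lambda>z. f (of_real s * z))"
proof -
  obtain R where R: "1 < R" "(\<lambda>z. f (of_real s * z)) holomorphic_on ball 0 R"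
    by (rule holomorphic_on_dilate[OF assms(1-3)])
  have "S \<subseteq> ball 0 R" using R(1) assms(4) by force
  then show ?thesis
    using holomorphic_on_imp_continuous_on[OF R(2)] continuous_on_subset by blast
qed

lemma h2_mean_eq:
  assumes "f holomorphic_on ball 0 1" "0 \<le> s" "s < 1"
  shows "h2_mean f s = circle_mean (\<lambda>z. (cmod (f (of_real s * z)))\<^sup>2)"
  by (intro h2_mean_eq_circle_mean continuous_on_dilate[OF assms]) auto

lemma le_of_forall_pos_mult:
  fixes a b c :: real
  assumes "\<And>e. 0 < e \<Longrightarrow> a \<le> c * (b + e)" "0 < c"
  shows "a \<le> c * b"
proof (rule field_le_epsilon)
  fix e :: real assume "0 < e"
  then show "a \<le> c * b + e" using assms(1)[of "e / c"] \<open>0 < c\<close> by (simp add: distrib_left)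
qed

text \<open>Composing the harmonic majorant Re q of |F|^2 with \<psi> keeps it harmonic, so its mean
  is its value at \<psi> 0. Harnack compares that value with the one at 0, which is the mean of Re q
  on the circle; the constant is Harnack's.\<close>

lemma circle_mean_subordinate:
  assumes F: "F holomorphic_on ball 0 R" "1 < R"
    and \<psi>: "continuous_on (cball 0 1) \<psi>" "\<psi> holomorphic_on ball 0 1" "\<psi> ` cball 0 1 \<subseteq> cball 0 1" "cmod (\<psi> 0) < 1"
  shows "circle_mean (\<lambda>z. (cmod (F (\<psi> z)))\<^sup>2)
    \<le> (1 + cmod (\<psi> 0)) / (1 - cmod (\<psi> 0)) * circle_mean (\<lambda>z. (cmod (F z))\<^sup>2)"
proof (rule le_of_forall_pos_mult)
  let ?C = "(1 + cmod (\<psi> 0)) / (1 - cmod (\<psi> 0))"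
  show "0 < ?C" using \<psi>(4) by (intro divide_pos_pos add_pos_nonneg) auto
  fix e :: real assume "0 < e"
  then obtain q where q: "\<And>z. cmod z \<le> 1 \<Longrightarrow> (cmod (F z))\<^sup>2 \<le> Re (poly q z)"
    "\<And>z. cmod z = 1 \<Longrightarrow> Re (poly q z) \<le> (cmod (F z))\<^sup>2 + e"
    using holomorphic_square_poly_majorant[OF F] by metis
  have contF: "continuous_on (cball 0 1) F"
    by (rule holomorphic_on_imp_continuous_on, rule holomorphic_on_subset[OF F(1)]) (use F(2) in auto)
  have cont: "continuous_on (sphere 0 1) (\<lambda>z. F (\<psi> z))"
    by (rule continuous_on_compose2[OF contF]) (use \<psi>(3) in \<open>auto intro: continuous_on_subset[OF \<psi>(1)]\<close>)
  have cont\<psi>: "continuous_on (sphere 0 1) \<psi>" by (rule continuous_on_subset[OF \<psi>(1)]) auto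
  have contF': "continuous_on (sphere 0 1) F" by (rule continuous_on_subset[OF contF]) auto
  have "circle_mean (\<lambda>z. (cmod (F (\<psi> z)))\<^sup>2) \<le> circle_mean (\<lambda>z. Re (poly q (\<psi> z)))"
    by (intro circle_mean_mono continuous_intros cont cont\<psi> q(1)) (use \<psi>(3) in force)
  also have "\<dots> = Re (poly q (\<psi> 0))"
    by (rule circle_mean_Re_holomorphic) (intro continuous_intros holomorphic_intros \<psi>)+
  also have "\<dots> \<le> ?C * Re (poly q 0)"
    by (rule harnack_poly(2)[OF \<psi>(4)]) (rule order_trans[OF _ q(1)], auto)
  also have "\<dots> \<le> ?C * circle_mean (\<lambda>z. (cmod (F z))\<^sup>2 + e)"
    unfolding circle_mean_Re_poly[symmetric] using \<open>0 < ?C\<close>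
    by (intro mult_left_mono circle_mean_mono continuous_intros contF' q(2)) simp_all
  also have "circle_mean (\<lambda>z. (cmod (F z))\<^sup>2 + e) = circle_mean (\<lambda>z. (cmod (F z))\<^sup>2) + e"
    by (subst circle_mean_add) (auto intro!: continuous_intros contF')
  finally show "circle_mean (\<lambda>z. (cmod (F (\<psi> z)))\<^sup>2) \<le> ?C * (circle_mean (\<lambda>z. (cmod (F z))\<^sup>2) + e)" .
qed

text \<open>Subordination to the contraction by r / s, which fixes 0 and so has constant 1.\<close>

lemma h2_mean_mono:
  assumes "f holomorphic_on ball 0 1" "0 \<le> r" "r \<le> s" "s < 1"
  shows "h2_mean f r \<le> h2_mean f s"
proof (cases "s = 0")
  case False
  with assms have s: "0 < s" by auto
  obtain R where R: "1 < R" "(\<lambda>z. f (of_real s * z)) holomorphic_on ball 0 R"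
    using holomorphic_on_dilate[OF assms(1), of s] s assms by auto
  have "complex_of_real s * of_real (r / s) = of_real r"
    using s by simp
  then have eq: "complex_of_real s * (of_real (r / s) * z) = of_real r * z" for z
    by (metis mult.assoc)
  have "r / s * cmod z \<le> 1" if "cmod z \<le> 1" for z
    using assms s that by (intro mult_le_one) (auto simp: field_simps)
  then have "(*) (complex_of_real (r / s)) ` cball 0 1 \<subseteq> cball 0 1"
    using assms s by (auto simp: norm_mult norm_divide)
  then have "circle_mean (\<lambda>z. (cmod (f (of_real s * (of_real (r / s) * z))))\<^sup>2)
      \<le> (1 + cmod (of_real (r / s) * 0)) / (1 - cmod (of_real (r / s) * 0)) * circle_mean (\<lambda>z. (cmod (f (of_real s * z)))\<^sup>2)"
    using R s by (intro circle_mean_subordinate) (auto intro!: continuous_intros holomorphic_intros)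
  then show ?thesis using assms s by (simp add: h2_mean_eq eq)
qed (use assms in auto)

text \<open>The circle version needs an outer function holomorphic past the unit circle. On the
  circle of radius r the values of \<psi> stay within some \<rho> < 1, which leaves room to dilate
  f.\<close>

lemma littlewood_subordination:
  assumes f: "f holomorphic_on ball 0 1" "\<And>s. 0 \<le> s \<Longrightarrow> s < 1 \<Longrightarrow> h2_mean f s \<le> B"
    and \<psi>: "\<psi> holomorphic_on ball 0 1" "\<psi> ` ball 0 1 \<subseteq> ball 0 1"
    and r: "0 \<le> r" "r < 1"
  shows "h2_mean (\<lambda>z. f (\<psi> z)) r \<le> (1 + cmod (\<psi> 0)) / (1 - cmod (\<psi> 0)) * B"
proof -
  define x where "x = cmod (\<psi> 0)"
  have x: "0 \<le> x" "x < 1" using \<psi>(2) by (auto simp: x_def image_subset_iff)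
  have B: "0 \<le> B" using order_trans[OF h2_mean_nonneg f(2)[of 0]] by simp
  have cont: "continuous_on (cball 0 1) (\<lambda>z. \<psi> (of_real r * z))"
    by (rule continuous_on_dilate[OF \<psi>(1) r]) auto
  have rz: "cmod (of_real r * z) < 1" if "cmod z \<le> 1" for z
    using r that mult_left_mono[of "cmod z" 1 r] by (simp add: norm_mult)
  have hol: "(\<lambda>z. \<psi> (of_real r * z)) holomorphic_on ball 0 1"
    by (rule holomorphic_on_compose_gen[OF _ \<psi>(1), unfolded o_def])
       (use rz in \<open>auto intro!: holomorphic_intros simp del: norm_mult\<close>)
  have "\<exists>z0\<in>cball 0 1. \<forall>z\<in>cball 0 1. cmod (\<psi> (of_real r * z)) \<le> cmod (\<psi> (of_real r * z0))"
    by (intro continuous_attains_sup continuous_intros cont) auto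
  then obtain z0 where z0: "z0 \<in> cball 0 1"
    "\<And>z. z \<in> cball 0 1 \<Longrightarrow> cmod (\<psi> (of_real r * z)) \<le> cmod (\<psi> (of_real r * z0))"
    by blast
  define \<rho> where "\<rho> = cmod (\<psi> (of_real r * z0))"
  have \<rho>: "\<rho> < 1" "0 \<le> \<rho>" using \<psi>(2) rz[of z0] z0(1) by (auto simp: \<rho>_def image_subset_iff)
  have le\<rho>: "cmod (\<psi> (of_real r * z)) \<le> \<rho>" if "cmod z \<le> 1" for z
    using z0(2)[of z] that by (simp add: \<rho>_def)
  \<comment> \<open>The dilation of f by s is undone by dividing \<psi> by s; the quotient is still
    bounded by 1 because s > \<rho>. The price is x / s in place of x, removed by letting s tend to
    1.\<close>
  have "h2_mean (\<lambda>z. f (\<psi> z)) r \<le> (1 + x / s) / (1 - x / s) * B" if s: "\<rho> < s" "s < 1" for s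
  proof -
    have s0: "0 < s" using s \<rho> by linarith
    obtain R where R: "1 < R" "(\<lambda>z. f (of_real s * z)) holomorphic_on ball 0 R"
      using holomorphic_on_dilate[OF f(1), of s] s0 s by auto
    have x': "x / s < 1" using le\<rho>[of 0] s s0 by (simp add: x_def)
    have "circle_mean (\<lambda>z. (cmod (f (of_real s * (\<psi> (of_real r * z) / of_real s))))\<^sup>2)
        \<le> (1 + cmod (\<psi> (of_real r * 0) / of_real s)) / (1 - cmod (\<psi> (of_real r * 0) / of_real s))
           * circle_mean (\<lambda>z. (cmod (f (of_real s * z)))\<^sup>2)"
    proof (rule circle_mean_subordinate[OF R(2,1)])
      show "(\<lambda>z. \<psi> (of_real r * z) / of_real s) ` cball 0 1 \<subseteq> cball 0 1"
        using le\<rho> s s0 by (force simp: norm_divide)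
    qed (use s0 x' in \<open>auto intro!: continuous_intros holomorphic_intros cont hol simp: norm_divide x_def\<close>)
    also have "\<dots> = (1 + x / s) / (1 - x / s) * h2_mean f s"
      using s0 s by (simp add: h2_mean_eq f norm_divide x_def)
    also have "\<dots> \<le> (1 + x / s) / (1 - x / s) * B"
      using x x' s0 s by (intro mult_left_mono f(2)) auto
    finally show ?thesis
      using s0 h2_mean_eq[of "\<lambda>z. f (\<psi> z)" r] r holomorphic_on_compose_gen[OF \<psi>(1) f(1) \<psi>(2)]
      by (simp add: o_def)
  qed
  then have "eventually (\<lambda>s. h2_mean (\<lambda>z. f (\<psi> z)) r \<le> (1 + x / s) / (1 - x / s) * B) (at_left 1)"
    using \<rho> eventually_at_left_field by blast
  moreover have "((\<lambda>s. (1 + x / s) / (1 - x / s) * B) \<longlongrightarrow> (1 + x / 1) / (1 - x / 1) * B) (at_left 1)"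
    using x by (intro tendsto_intros) auto
  ultimately show ?thesis
    using tendsto_lowerbound[of _ _ "at_left (1::real)"] by (fastforce simp: x_def)
qed

text \<open>Subordination to the constant map with value z.\<close>

lemma h2_point_evaluation:
  assumes f: "f holomorphic_on ball 0 1" "\<And>s. 0 \<le> s \<Longrightarrow> s < 1 \<Longrightarrow> h2_mean f s \<le> B" and z: "cmod z < 1"
  shows "(cmod (f z))\<^sup>2 \<le> (1 + cmod z) / (1 - cmod z) * B"
proof -
  have "h2_mean (\<lambda>_. f z) 0 \<le> (1 + cmod z) / (1 - cmod z) * B"
    by (rule littlewood_subordination[OF f, of "\<lambda>_. z"]) (use z in auto)
  then show ?thesis by (subst (asm) h2_mean_eq) auto
qed

section \<open>Dilations\<close>

lemma holomorphic_on_compose_scale: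
  assumes "f holomorphic_on ball 0 1" "0 \<le> \<rho>" "\<rho> \<le> 1"
  shows "(\<lambda>z. f (of_real \<rho> * z)) holomorphic_on ball 0 1"
proof -
  have "complex_of_real \<rho> * z \<in> ball 0 1" if "z \<in> ball 0 1" for z
    using assms that mult_right_mono[of \<rho> 1 "cmod z"] by (simp add: norm_mult)
  then show ?thesis
    by (intro holomorphic_on_compose_gen[OF _ assms(1), unfolded o_def]) (auto intro!: holomorphic_intros)
qed

lemma circle_mean_square_tendsto:
  fixes f :: "nat \<Rightarrow> complex \<Rightarrow> complex"
  assumes "uniform_limit (sphere 0 1) f g sequentially"
    and "\<And>n. continuous_on (sphere 0 1) (f n)" "continuous_on (sphere 0 1) g"
  shows "(\<lambda>n. circle_mean (\<lambda>z. (cmod (f n z))\<^sup>2)) \<longlonglongrightarrow> circle_mean (\<lambda>z. (cmod (g z))\<^sup>2)"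
proof (rule circle_mean_tendsto)
  have "bounded ((\<lambda>z. cmod (g z)) ` sphere 0 1)"
    by (intro compact_imp_bounded compact_continuous_image continuous_intros assms) auto
  then show "uniform_limit (sphere 0 1) (\<lambda>n z. (cmod (f n z))\<^sup>2) (\<lambda>z. (cmod (g z))\<^sup>2) sequentially"
    unfolding power2_eq_square by (intro uniform_lim_mult uniform_limit_norm assms)
qed (auto intro!: continuous_intros assms)

text \<open>By orthogonality of the monomials both sides equal the sum of |a_n|^2 (\<alpha>
  \<beta>)^n, which depends on the product \<alpha> \<beta> alone. The recursion peels off the
  constant coefficient.\<close>

lemma circle_mean_poly_cnj_poly:
  fixes p :: "complex poly"
  assumes "\<alpha> * \<beta> = \<gamma> * \<gamma>"
  shows "circle_mean (\<lambda>z. poly p (of_real \<alpha> * z) * cnj (poly p (of_real \<beta> * z)))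
    = circle_mean (\<lambda>z. poly p (of_real \<gamma> * z) * cnj (poly p (of_real \<gamma> * z)))"
proof (induction p)
  case 0
  show ?case by simp
next
  case (pCons a p)
  define X where "X x y = circle_mean (\<lambda>z. poly p (of_real x * z) * cnj (poly p (of_real y * z)))" for x y :: real
  have rec: "circle_mean (\<lambda>z. poly (pCons a p) (of_real x * z) * cnj (poly (pCons a p) (of_real y * z)))
      = a * cnj a + of_real (x * y) * X x y" for x y :: real
  proof -
    define h where "h z = of_real x * z * poly p (of_real x * z)" for z
    define k where "k z = of_real y * z * poly p (of_real y * z)" for z
    have "circle_mean h = h 0"
      by (rule circle_mean_holomorphic) (auto simp: h_def[abs_def] intro!: continuous_intros holomorphic_intros)
    moreover have "circle_mean k = k 0"
      by (rule circle_mean_holomorphic) (auto simp: k_def[abs_def] intro!: continuous_intros holomorphic_intros)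
    ultimately have mean: "circle_mean h = 0" "circle_mean k = 0" by (auto simp: h_def k_def)
    have cont: "continuous_on (sphere 0 1) h" "continuous_on (sphere 0 1) k"
      unfolding h_def k_def by (auto intro!: continuous_intros)
    have cnj0: "circle_mean (\<lambda>z. cnj (k z)) = 0"
      using circle_mean_bounded_linear[OF bounded_linear_cnj cont(2)] mean by simp
    have "circle_mean (\<lambda>z. poly (pCons a p) (of_real x * z) * cnj (poly (pCons a p) (of_real y * z)))
      = circle_mean (\<lambda>z. a * cnj a + (a * cnj (k z) + (cnj a * h z
          + of_real (x * y) * (poly p (of_real x * z) * cnj (poly p (of_real y * z))))))"
    proof (rule circle_mean_cong)
      fix z :: complex assume "cmod z = 1"
      then have "z * cnj z = 1" by (rule cnj_mult_self_circle)
      moreover have "h z * cnj (k z)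
          = of_real (x * y) * (z * cnj z) * (poly p (of_real x * z) * cnj (poly p (of_real y * z)))"
        by (simp add: h_def k_def mult_ac)
      moreover have "poly (pCons a p) (of_real x * z) * cnj (poly (pCons a p) (of_real y * z))
          = a * cnj a + (a * cnj (k z) + (cnj a * h z + h z * cnj (k z)))"
        by (simp add: h_def k_def algebra_simps)
      ultimately show "poly (pCons a p) (of_real x * z) * cnj (poly (pCons a p) (of_real y * z))
        = a * cnj a + (a * cnj (k z) + (cnj a * h z
          + of_real (x * y) * (poly p (of_real x * z) * cnj (poly p (of_real y * z)))))"
        by simp
    qed
    also have "\<dots> = a * cnj a + of_real (x * y) * X x y"
      unfolding X_def
      by (simp add: circle_mean_add circle_mean_mult_left continuous_on_add continuous_on_mult_left
        continuous_on_mult continuous_on_cnj cont mean cnj0 continuous_on_poly continuous_on_const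
        continuous_on_id del: of_real_mult)
    finally show ?thesis .
  qed
  show ?case unfolding rec using pCons assms by (simp add: X_def)
qed

lemma circle_mean_poly_dilate_diff:
  fixes p :: "complex poly"
  assumes "\<alpha> * \<beta> = \<gamma> * \<gamma>"
  shows "circle_mean (\<lambda>z. (cmod (poly p (of_real \<alpha> * z) - poly p (of_real \<beta> * z)))\<^sup>2)
    = circle_mean (\<lambda>z. (cmod (poly p (of_real \<alpha> * z)))\<^sup>2) + circle_mean (\<lambda>z. (cmod (poly p (of_real \<beta> * z)))\<^sup>2)
      - 2 * circle_mean (\<lambda>z. (cmod (poly p (of_real \<gamma> * z)))\<^sup>2)"
proof -
  define u v where "u z = poly p (of_real \<alpha> * z)" and "v z = poly p (of_real \<beta> * z)" for z
  have cont: "continuous_on (sphere 0 1) u" "continuous_on (sphere 0 1) v"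
    unfolding u_def v_def by (auto intro!: continuous_intros)
  have "(cmod (u z - v z))\<^sup>2 = (cmod (u z))\<^sup>2 + (cmod (v z))\<^sup>2 - 2 * Re (u z * cnj (v z))" for z
    by (simp only: cmod_power2 minus_complex.sel times_complex.sel cnj.sel) algebra
  then have "circle_mean (\<lambda>z. (cmod (u z - v z))\<^sup>2)
      = circle_mean (\<lambda>z. (cmod (u z))\<^sup>2) + circle_mean (\<lambda>z. (cmod (v z))\<^sup>2) - 2 * circle_mean (\<lambda>z. Re (u z * cnj (v z)))"
    by (simp add: circle_mean_add circle_mean_diff circle_mean_mult_left continuous_on_add continuous_on_mult_left
        continuous_on_mult continuous_on_cnj continuous_on_Re continuous_on_power continuous_on_norm cont
        del: times_complex.sel)
  also have "circle_mean (\<lambda>z. Re (u z * cnj (v z))) = Re (circle_mean (\<lambda>z. u z * cnj (v z)))"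
    by (intro circle_mean_bounded_linear bounded_linear_Re continuous_intros cont)
  also have "\<dots> = Re (circle_mean (\<lambda>z. poly p (of_real \<gamma> * z) * cnj (poly p (of_real \<gamma> * z))))"
    unfolding u_def v_def using circle_mean_poly_cnj_poly[OF assms] by simp
  also have "\<dots> = circle_mean (\<lambda>z. Re (poly p (of_real \<gamma> * z) * cnj (poly p (of_real \<gamma> * z))))"
    by (rule circle_mean_bounded_linear[symmetric]) (intro bounded_linear_Re continuous_intros)+
  also have "\<dots> = circle_mean (\<lambda>z. (cmod (poly p (of_real \<gamma> * z)))\<^sup>2)"
    by (rule circle_mean_cong) (simp only: complex_norm_square[symmetric] Re_complex_of_real)
  finally show ?thesis by (simp add: u_def v_def)
qed

text \<open>In coefficients this is (1 - \<rho>^n)^2 = 1 + \<rho>^(2 n) - 2 \<rho>^n, summed against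
  |a_n|^2 s^(2 n). The cross term is the mean at radius sqrt \<rho> s because the product of the
  radii s and \<rho> s is (sqrt \<rho> s)^2. It reduces the distance from f to its dilation to
  increments of a monotone function.\<close>

lemma h2_mean_dilate_diff:
  assumes f: "f holomorphic_on ball 0 1" and s: "0 \<le> s" "s < 1" and \<rho>: "0 \<le> \<rho>" "\<rho> \<le> 1"
  shows "h2_mean (\<lambda>z. f z - f (of_real \<rho> * z)) s
    = h2_mean f s + h2_mean f (\<rho> * s) - 2 * h2_mean f (sqrt \<rho> * s)"
proof -
  define F where "F z = f (of_real s * z)" for z
  obtain R where R: "1 < R" "F holomorphic_on ball 0 R"
    using holomorphic_on_dilate[OF f s] unfolding F_def by blast
  have "\<exists>p. \<forall>z. cmod z \<le> 1 \<longrightarrow> cmod (poly p z - F z) < inverse (Suc n)" for n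
    using holomorphic_poly_approx[OF R(2,1), of "inverse (Suc n)"] by (metis inverse_positive_iff_positive of_nat_0_less_iff zero_less_Suc)
  then obtain p where p: "\<And>n z. cmod z \<le> 1 \<Longrightarrow> cmod (poly (p n) z - F z) < inverse (Suc n)"
    by metis
  have unif: "uniform_limit (cball 0 1) (\<lambda>n. poly (p n)) F sequentially"
  proof (rule uniform_limitI)
    fix e :: real assume "0 < e"
    then obtain N where "inverse (real (Suc N)) < e" using reals_Archimedean by blast
    then have "inverse (real (Suc n)) < e" if "n \<ge> N" for n
      using that by (smt (verit) inverse_le_iff_le of_nat_0_less_iff of_nat_le_iff zero_less_Suc Suc_le_mono)
    then show "\<forall>\<^sub>F n in sequentially. \<forall>z\<in>cball 0 1. dist (poly (p n) z) (F z) < e"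
      unfolding eventually_sequentially dist_norm using p by (meson less_trans mem_cball_0)
  qed
  have contF: "continuous_on (cball 0 1) F"
    unfolding F_def by (rule continuous_on_dilate[OF f s]) auto
  have scaled: "uniform_limit (sphere 0 1) (\<lambda>n z. poly (p n) (of_real x * z)) (\<lambda>z. F (of_real x * z)) sequentially"
    and contx: "continuous_on (sphere 0 1) (\<lambda>z. F (of_real x * z))" if "0 \<le> x" "x \<le> 1" for x
  proof -
    have sub: "(\<lambda>z. complex_of_real x * z) \<in> sphere 0 1 \<rightarrow> cball 0 1" using that by (auto simp: norm_mult)
    show "uniform_limit (sphere 0 1) (\<lambda>n z. poly (p n) (of_real x * z)) (\<lambda>z. F (of_real x * z)) sequentially"
      by (rule uniform_limit_compose'[OF unif sub])
    show "continuous_on (sphere 0 1) (\<lambda>z. F (of_real x * z))"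
      by (rule continuous_on_compose2[OF contF]) (use sub in \<open>auto intro!: continuous_intros\<close>)
  qed
  have lim: "(\<lambda>n. circle_mean (\<lambda>z. (cmod (poly (p n) (of_real x * z)))\<^sup>2)) \<longlonglongrightarrow> h2_mean f (x * s)"
    if x: "0 \<le> x" "x \<le> 1" for x
  proof -
    have "x * s < 1" using s x mult_right_mono[of x 1 s] by simp
    then have "h2_mean f (x * s) = circle_mean (\<lambda>z. (cmod (F (of_real x * z)))\<^sup>2)"
      using h2_mean_eq[OF f, of "x * s"] s x by (simp add: F_def mult_ac)
    then show ?thesis
      by (simp only:) (intro circle_mean_square_tendsto scaled contx x continuous_intros)
  qed
  have g: "(\<lambda>z. f z - f (of_real \<rho> * z)) holomorphic_on ball 0 1"
    using \<rho> by (intro holomorphic_intros f holomorphic_on_compose_scale)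
  have eq: "h2_mean (\<lambda>z. f z - f (of_real \<rho> * z)) s = circle_mean (\<lambda>z. (cmod (F (of_real 1 * z) - F (of_real \<rho> * z)))\<^sup>2)"
    using h2_mean_eq[OF g s] by (simp add: F_def mult_ac)
  have lim1: "(\<lambda>n. circle_mean (\<lambda>z. (cmod (poly (p n) (of_real 1 * z) - poly (p n) (of_real \<rho> * z)))\<^sup>2))
      \<longlonglongrightarrow> circle_mean (\<lambda>z. (cmod (F (of_real 1 * z) - F (of_real \<rho> * z)))\<^sup>2)"
    using \<rho> by (intro circle_mean_square_tendsto uniform_limit_intros scaled continuous_intros contx) auto
  have lim2: "(\<lambda>n. circle_mean (\<lambda>z. (cmod (poly (p n) (of_real 1 * z) - poly (p n) (of_real \<rho> * z)))\<^sup>2))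
      \<longlonglongrightarrow> h2_mean f (1 * s) + h2_mean f (\<rho> * s) - 2 * h2_mean f (sqrt \<rho> * s)"
    by (subst circle_mean_poly_dilate_diff[where \<gamma> = "sqrt \<rho>"])
       (use \<rho> in simp, intro tendsto_intros lim, use \<rho> in auto)
  show ?thesis using LIMSEQ_unique[OF lim1 lim2] eq by simp
qed

section \<open>Radial limits\<close>

lemma poisson_kernel_real_eq:
  assumes "\<bar>r\<bar> < 1"
  shows "poisson_kernel (of_real r) (cis x) = (1 - r\<^sup>2) / (1 - 2 * r * cos x + r\<^sup>2)"
proof -
  have "(cmod (cis x - of_real r))\<^sup>2 = (cos x - r)\<^sup>2 + (sin x)\<^sup>2"
    by (simp add: cmod_power2)
  also have "\<dots> = 1 - 2 * r * cos x + r\<^sup>2"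
    using sin_cos_squared_add2[of x] by (simp add: power2_eq_square algebra_simps)
  finally show ?thesis by (simp add: poisson_kernel_def)
qed

lemma poisson_denominator_pos:
  fixes r :: real
  assumes "0 \<le> r" "r < 1"
  shows "0 < 1 - 2 * r * cos x + r\<^sup>2"
proof -
  have "0 < (1 - r)\<^sup>2" using assms by simp
  also have "(1 - r)\<^sup>2 \<le> 1 - 2 * r * cos x + r\<^sup>2"
    using assms mult_left_mono[of "cos x" 1 r] by (simp add: power2_eq_square algebra_simps)
  finally show ?thesis .
qed

lemma integral_symmetrize:
  fixes h :: "real \<Rightarrow> real"
  assumes "continuous_on {0..2*pi} h"
  shows "integral {0..2*pi} h = integral {0..pi} (\<lambda>x. h x + h (2*pi - x))"
proof -
  have int: "h integrable_on {a..b}" if "0 \<le> a" "b \<le> 2*pi" for a b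
    by (rule integrable_continuous_real, rule continuous_on_subset[OF assms]) (use that in auto)
  have "(h has_integral integral {pi..2*pi} h) {pi..2*pi}"
    by (rule integrable_integral) (rule int, auto)
  then have "((\<lambda>x. h (x + 2*pi)) has_integral integral {pi..2*pi} h) {pi - 2*pi..2*pi - 2*pi}"
    by (rule has_integral_shift_real_ivl)
  then have "((\<lambda>x. h (- x + 2*pi)) has_integral integral {pi..2*pi} h) {0..pi}"
    using has_integral_reflect_real[of "\<lambda>x. h (x + 2*pi)" "integral {pi..2*pi} h" 0 "-pi"] by simp
  then have refl: "((\<lambda>x. h (2*pi - x)) has_integral integral {pi..2*pi} h) {0..pi}" by simp
  have "integral {0..2*pi} h = integral {0..pi} h + integral {pi..2*pi} h"
    by (rule Henstock_Kurzweil_Integration.integral_combine[symmetric]) (auto intro: int)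
  also have "\<dots> = integral {0..pi} (\<lambda>x. h x + h (2*pi - x))"
    using has_integral_add[OF integrable_integral[OF int[of 0 pi]] refl] by (simp add: integral_unique)
  finally show ?thesis .
qed

text \<open>Rotating by t moves the point to the real axis, where the kernel is even in the angle;
  folding the circle there leaves the symmetric sum of boundary values on [0, pi].\<close>

lemma poisson_formula_angle:
  assumes "0 \<le> r" "r < 1"
  shows "2 * pi * Re (poly q (of_real r * cis t))
    = integral {0..pi} (\<lambda>x. (1 - r\<^sup>2) / (1 - 2 * r * cos x + r\<^sup>2)
        * (Re (poly q (cis (t + x))) + Re (poly q (cis (t - x)))))"
proof -
  define k where "k x = (1 - r\<^sup>2) / (1 - 2 * r * cos x + r\<^sup>2)" for x
  define h where "h x = k x * Re (poly q (cis (t + x)))" for x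
  have nz: "1 - 2 * r * cos x + r\<^sup>2 \<noteq> 0" for x
    using poisson_denominator_pos[OF assms, of x] by simp
  define q' where "q' = pcompose q [:0, cis t:]"
  have q': "poly q' z = poly q (cis t * z)" for z
    by (simp add: q'_def poly_pcompose mult.commute)
  have "Re (poly q' (of_real r)) = circle_mean (\<lambda>\<zeta>. poisson_kernel (of_real r) \<zeta> * Re (poly q' \<zeta>))"
    using poisson_formula_Re_poly[of "of_real r" q'] assms by simp
  also have "\<dots> = (1 / (2*pi)) * integral {0..2*pi} h"
    using assms by (simp add: circle_mean_def poisson_kernel_real_eq h_def[abs_def] k_def q' cis_mult)
  also have "integral {0..2*pi} h = integral {0..pi} (\<lambda>x. h x + h (2*pi - x))"
    by (rule integral_symmetrize) (auto simp: h_def k_def nz intro!: continuous_intros)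
  also have "(\<lambda>x. h x + h (2*pi - x)) = (\<lambda>x. k x * (Re (poly q (cis (t + x))) + Re (poly q (cis (t - x)))))"
  proof
    fix x
    have "cis (t + (2*pi - x)) = cis (t - x)"
      using cis_mult[of "t - x" "2*pi"] by (simp add: diff_add_eq add_diff_eq)
    moreover have "k (2*pi - x) = k x" by (simp add: k_def)
    ultimately show "h x + h (2*pi - x) = k x * (Re (poly q (cis (t + x))) + Re (poly q (cis (t - x))))"
      by (simp add: h_def distrib_left)
  qed
  finally show ?thesis by (simp add: q' k_def mult.commute)
qed

text \<open>Integration by parts against the radially decreasing Poisson kernel: a bound on all
  centred means of the boundary values bounds the Poisson integral.\<close>

lemma poisson_le_of_means_le:
  fixes q :: "complex poly"
  defines "g \<equiv> \<lambda>x. Re (poly q (cis x))"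
  assumes r: "0 \<le> r" "r < 1"
    and means: "\<And>x. 0 < x \<Longrightarrow> x \<le> pi \<Longrightarrow> integral {t - x..t + x} g \<le> 2 * M * x"
  shows "Re (poly q (of_real r * cis t)) \<le> M"
proof -
  define k where "k x = (1 - r\<^sup>2) / (1 - 2 * r * cos x + r\<^sup>2)" for x
  define k' where "k' x = - ((1 - r\<^sup>2) * (2 * r * sin x)) / (1 - 2 * r * cos x + r\<^sup>2)\<^sup>2" for x
  \<comment> \<open>The base point t - 4 lies to the left of every t - x with x \<le> pi, so the
    primitive is differentiable at all points used.\<close>
  define \<Gamma> where "\<Gamma> x = integral {t - 4..x} g" for x
  \<comment> \<open>The slack in the hypothesis on the centred integrals: nonnegative on [0, pi] and
    zero at 0.\<close>
  define D where "D x = 2 * M * x - (\<Gamma> (t + x) - \<Gamma> (t - x))" for x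
  have contg: "continuous_on S g" for S
    unfolding g_def by (intro continuous_intros)
  have pos: "0 < 1 - 2 * r * cos x + r\<^sup>2" for x by (rule poisson_denominator_pos[OF r])
  have nz: "1 - 2 * r * cos x + r\<^sup>2 \<noteq> 0" for x using pos[of x] by simp
  have \<Gamma>: "(\<Gamma> has_real_derivative g x) (at x)" if "t - 4 < x" "x < t + 4" for x
  proof -
    have "(\<Gamma> has_real_derivative g x) (at x within {t - 4..t + 4})"
      unfolding \<Gamma>_def by (rule integral_has_real_derivative[OF contg]) (use that in auto)
    moreover have "at x within {t - 4..t + 4} = at x"
      using that by (intro at_within_interior) auto
    ultimately show ?thesis by simp
  qed
  have \<Gamma>_diff: "\<Gamma> (t + x) - \<Gamma> (t - x) = integral {t - x..t + x} g" if "0 \<le> x" "x \<le> pi" for x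
  proof -
    have "integral {t - 4..t - x} g + integral {t - x..t + x} g = integral {t - 4..t + x} g"
      by (rule Henstock_Kurzweil_Integration.integral_combine)
         (use that pi_less_4 in \<open>auto intro!: integrable_continuous_real contg\<close>)
    then show ?thesis by (simp add: \<Gamma>_def)
  qed
  have D_nonneg: "0 \<le> D x" if "0 \<le> x" "x \<le> pi" for x
    using means[of x] \<Gamma>_diff[OF that] that by (cases "x = 0") (auto simp: D_def)
  have dk: "(k has_real_derivative k' x) (at x)" for x
    unfolding k_def[abs_def] k'_def
    by (rule derivative_eq_intros refl | use pos[of x] in \<open>simp add: power2_eq_square\<close>)+
  have dD: "(D has_real_derivative (2 * M - (g (t + x) + g (t - x)))) (at x)" if "0 \<le> x" "x \<le> pi" for x
  proof -
    have "((\<lambda>x. \<Gamma> (t + x)) has_real_derivative g (t + x) * 1) (at x)"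
      by (rule DERIV_chain2[of \<Gamma>]) (use that pi_less_4 in \<open>auto intro!: \<Gamma> derivative_eq_intros\<close>)
    moreover have "((\<lambda>x. \<Gamma> (t - x)) has_real_derivative g (t - x) * (-1)) (at x)"
      by (rule DERIV_chain2[of \<Gamma>]) (use that pi_less_4 in \<open>auto intro!: \<Gamma> derivative_eq_intros\<close>)
    ultimately show ?thesis
      unfolding D_def[abs_def] by (auto intro!: derivative_eq_intros)
  qed
  have contD: "continuous_on {0..pi} D"
    by (rule DERIV_continuous_on) (use dD in \<open>auto intro: has_field_derivative_at_within\<close>)
  have contk: "continuous_on {0..pi} k" and contk': "continuous_on {0..pi} k'"
    unfolding k_def[abs_def] k'_def[abs_def] by (auto intro!: continuous_intros simp: nz)
  define u where "u x = k x * (2 * M - (g (t + x) + g (t - x)))" for x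
  have contg': "continuous_on S (\<lambda>x. g (t + x))" "continuous_on S (\<lambda>x. g (t - x))" for S
    unfolding g_def by (intro continuous_intros)+
  have contu: "continuous_on {0..pi} u"
    unfolding u_def by (intro continuous_intros contk contg')
  \<comment> \<open>Integration by parts for k D. The boundary terms are nonnegative and k' D \<le>
    0, so the integral of u is nonnegative, which is the claim once k is known to have integral pi
    over [0, pi].\<close>
  have "((\<lambda>x. k' x * D x + u x) has_integral (k pi * D pi - k 0 * D 0)) {0..pi}"
  proof (rule fundamental_theorem_of_calculus)
    fix x assume "x \<in> {0..pi}"
    then have "((\<lambda>x. k x * D x) has_real_derivative k' x * D x + u x) (at x)"
      using DERIV_mult[OF dk[of x] dD[of x]] by (simp add: u_def algebra_simps)
    then show "((\<lambda>x. k x * D x) has_vector_derivative k' x * D x + u x) (at x within {0..pi})"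
      using has_real_derivative_iff_has_vector_derivative has_field_derivative_at_within by blast
  qed simp
  then have "integral {0..pi} (\<lambda>x. k' x * D x + u x) = k pi * D pi - k 0 * D 0"
    by (rule integral_unique)
  moreover have "D 0 = 0" by (simp add: D_def)
  moreover have "0 \<le> k pi * D pi"
    using r pos[of pi] by (intro mult_nonneg_nonneg D_nonneg) (auto simp: k_def power_le_one)
  moreover have "integral {0..pi} (\<lambda>x. k' x * D x + u x) \<le> integral {0..pi} u"
  proof (rule integral_le)
    fix x assume x: "x \<in> {0..pi}"
    have "k' x \<le> 0"
      using r x sin_ge_zero[of x] by (auto simp: k'_def power_le_one intro!: divide_nonneg_nonneg mult_nonneg_nonneg)
    then show "k' x * D x + u x \<le> u x"
      using D_nonneg[of x] x by (simp add: mult_nonpos_nonneg)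
  qed (auto intro!: integrable_continuous_real continuous_intros contk' contD contu)
  ultimately have "0 \<le> integral {0..pi} u" by simp
  also have "u = (\<lambda>x. M * (k x * 2) - k x * (g (t + x) + g (t - x)))"
    by (auto simp: u_def algebra_simps)
  also have "integral {0..pi} \<dots> = M * integral {0..pi} (\<lambda>x. k x * 2) - integral {0..pi} (\<lambda>x. k x * (g (t + x) + g (t - x)))"
    by (subst integral_diff) (auto intro!: integrable_continuous_real continuous_intros contk contg')
  \<comment> \<open>The total mass of the kernel comes from the same formula applied to the constant
    polynomial 1.\<close>
  also have "integral {0..pi} (\<lambda>x. k x * 2) = 2 * pi"
    using poisson_formula_angle[OF r, of 1 0] by (simp add: k_def)
  also have "integral {0..pi} (\<lambda>x. k x * (g (t + x) + g (t - x))) = 2 * pi * Re (poly q (of_real r * cis t))"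
    using poisson_formula_angle[OF r, of q t] by (simp add: k_def g_def)
  finally show ?thesis by simp
qed

text \<open>The shift by 2 keeps \<open>radii 0\<close> positive, so that these radii can be divided
  by.\<close>

definition radii :: "nat \<Rightarrow> real" where
  "radii n = 1 - inverse (real n + 2)"

lemma radii_bounds: "0 < radii n" "radii n < 1"
  by (auto simp: radii_def field_simps)

lemma radii_tendsto: "radii \<longlonglongrightarrow> 1"
proof -
  have "(\<lambda>n. 1 - inverse (real (Suc (Suc n)))) \<longlonglongrightarrow> 1 - 0"
    using LIMSEQ_Suc[OF LIMSEQ_inverse_real_of_nat] by (intro tendsto_intros) auto
  then show ?thesis by (simp add: radii_def[abs_def] add.commute)
qed

lemma radii_at_left: "filterlim radii (at_left 1) sequentially"
  unfolding filterlim_at using radii_tendsto radii_bounds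
  by (auto intro!: always_eventually simp: less_imp_neq)

lemma radii_eventually_gt: "r < 1 \<Longrightarrow> eventually (\<lambda>n. r < radii n) sequentially"
  using order_tendstoD(1)[OF radii_tendsto] .

section \<open>Weak-type estimate for the radial maximal function\<close>

lemma integral_periodic_triple:
  fixes g :: "real \<Rightarrow> real"
  assumes "continuous_on UNIV g" "\<And>x. g (x + 2*pi) = g x"
  shows "integral {-2*pi..4*pi} g = 3 * integral {0..2*pi} g"
proof -
  have int: "g integrable_on {a..b}" for a b
    by (rule integrable_continuous_real, rule continuous_on_subset[OF assms(1)]) auto
  have shift: "integral {a - 2*pi..b - 2*pi} g = integral {a..b} g" for a b
    using integral_shift_real_ivl[of a "2*pi" b g] assms(2) by simp
  have "integral {-2*pi..4*pi} g = integral {-2*pi..0} g + integral {0..2*pi} g + integral {2*pi..4*pi} g"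
    using Henstock_Kurzweil_Integration.integral_combine[OF _ _ int, of "-2*pi" 0 "4*pi"]
      Henstock_Kurzweil_Integration.integral_combine[OF _ _ int, of 0 "2*pi" "4*pi"] by simp
  moreover have "integral {-2*pi..0} g = integral {0..2*pi} g" using shift[of 0 "2*pi"] by simp
  moreover have "integral {0..2*pi} g = integral {2*pi..4*pi} g" using shift[of "2*pi" "4*pi"] by simp
  ultimately show ?thesis by simp
qed

text \<open>The supremum over uncountably many radii causes no measurability problem, since the set
  is a union of open sets. The endpoints of the period are left out for the sake of
  openness.\<close>

lemma open_radial_superlevel:
  fixes U :: "complex \<Rightarrow> real"
  assumes "continuous_on (ball 0 1) U"
  shows "open {t \<in> {0<..<2*pi}. \<exists>r. 0 \<le> r \<and> r < 1 \<and> \<kappa> < U (of_real r * cis t)}"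
proof -
  have "{t \<in> {0<..<2*pi}. \<exists>r. 0 \<le> r \<and> r < 1 \<and> \<kappa> < U (of_real r * cis t)}
      = {0<..<2*pi} \<inter> (\<Union>r\<in>{0..<1}. {t. \<kappa> < U (of_real r * cis t)})" by auto
  also have "open \<dots>"
  proof (intro open_Int open_greaterThanLessThan open_UN ballI open_Collect_less continuous_intros)
    fix r :: real assume "r \<in> {0..<1}"
    then show "continuous_on UNIV (\<lambda>t. U (of_real r * cis t))"
      by (intro continuous_on_compose2[OF assms]) (auto intro!: continuous_intros simp: norm_mult)
  qed
  finally show ?thesis .
qed

text \<open>A value above \<kappa> on the radius at t forces, by
  \<open>poisson_le_of_means_le\<close>, an interval centred at t on which the boundary values have
  mean above \<kappa>; Vitali's lemma then selects disjoint ones. The constant 30 pi is 5 for the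
  Vitali enlargement, 3 for the periods that the intervals may meet, and 2 pi for the normalisation
  of the mean.\<close>

lemma radial_maximal_weak_type_poly:
  fixes q :: "complex poly"
  assumes q: "\<And>z. cmod z = 1 \<Longrightarrow> 0 \<le> Re (poly q z)" and "0 < \<kappa>"
  shows "measure lborel {t \<in> {0<..<2*pi}. \<exists>r. 0 \<le> r \<and> r < 1 \<and> \<kappa> < Re (poly q (of_real r * cis t))}
    \<le> 30 * pi / \<kappa> * Re (poly q 0)" (is "measure lborel ?E \<le> ?B")
proof -
  define g where "g x = Re (poly q (cis x))" for x
  have contg: "continuous_on S g" for S unfolding g_def by (intro continuous_intros)
  have int: "g integrable_on {a..b}" for a b by (rule integrable_continuous_real[OF contg])
  have g0: "0 \<le> g x" for x unfolding g_def by (rule q) simp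
  have "cis (x + 2*pi) = cis x" for x by (simp flip: cis_mult)
  then have per: "g (x + 2*pi) = g x" for x by (simp add: g_def)
  define E where "E = ?E"
  have E_iff: "t \<in> E \<longleftrightarrow> 0 < t \<and> t < 2*pi \<and> (\<exists>r. 0 \<le> r \<and> r < 1 \<and> \<kappa> < Re (poly q (of_real r * cis t)))" for t
    by (simp add: E_def)
  have "\<exists>x. 0 < x \<and> x \<le> pi \<and> 2 * \<kappa> * x < integral {t - x..t + x} g" if t: "t \<in> E" for t
  proof (rule ccontr)
    assume "\<nexists>x. 0 < x \<and> x \<le> pi \<and> 2 * \<kappa> * x < integral {t - x..t + x} g"
    then have *: "integral {t - x..t + x} g \<le> 2 * \<kappa> * x" if "0 < x" "x \<le> pi" for x
      using that by force
    have "Re (poly q (of_real r * cis t)) \<le> \<kappa>" if "0 \<le> r" "r < 1" for r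
      by (rule poisson_le_of_means_le[OF that]) (rule *[unfolded g_def[abs_def]])
    then show False using t unfolding E_iff by force
  qed
  then have "\<forall>t\<in>E. \<exists>x. 0 < x \<and> x \<le> pi \<and> 2 * \<kappa> * x < integral {t - x..t + x} g" by blast
  from bchoice[OF this] obtain x where x: "\<And>t. t \<in> E \<Longrightarrow> 0 < x t" "\<And>t. t \<in> E \<Longrightarrow> x t \<le> pi"
    "\<And>t. t \<in> E \<Longrightarrow> 2 * \<kappa> * x t < integral {t - x t..t + x t} g"
    by blast
  have "E \<subseteq> (\<Union>t\<in>E. cball t (x t))"
  proof
    fix t assume "t \<in> E"
    then show "t \<in> (\<Union>t\<in>E. cball t (x t))" using x(1)[of t] by (intro UN_I[of t]) auto
  qed
  then obtain C where C: "countable C" "C \<subseteq> E"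
    "pairwise (\<lambda>i j. disjnt (cball i (x i)) (cball j (x j))) C"
    "E \<subseteq> (\<Union>i\<in>C. cball i (5 * x i))"
    by (rule Vitali_covering_lemma_cballs[where B = pi]) (use x in auto)
  have bound: "measure lborel (\<Union>i\<in>I. cball i (5 * x i)) \<le> ?B" if I: "I \<subseteq> C" "finite I" for I
  proof -
    have IE: "i \<in> E" if "i \<in> I" for i using that I C by blast
    have "measure lborel (\<Union>i\<in>I. cball i (5 * x i)) \<le> (\<Sum>i\<in>I. measure lborel (cball i (5 * x i)))"
      by (rule measure_UNION_le[OF I(2)]) auto
    also have "\<dots> = (\<Sum>i\<in>I. 5 / \<kappa> * (2 * \<kappa> * x i))"
      using x(1)[OF IE] \<open>0 < \<kappa>\<close> by (intro sum.cong) (auto simp: cball_eq_atLeastAtMost less_imp_le)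
    also have "\<dots> \<le> (\<Sum>i\<in>I. 5 / \<kappa> * integral (cball i (x i)) g)"
      using x(3)[OF IE] \<open>0 < \<kappa>\<close>
      by (intro sum_mono mult_left_mono) (auto simp: cball_eq_atLeastAtMost less_imp_le)
    also have "\<dots> = 5 / \<kappa> * (\<Sum>i\<in>I. integral (cball i (x i)) g)" by (simp add: sum_distrib_left)
    also have "(\<Sum>i\<in>I. integral (cball i (x i)) g) \<le> integral {-2*pi..4*pi} g"
    proof -
      have "pairwise (\<lambda>i j. negligible (cball i (x i) \<inter> cball j (x j))) I"
        by (rule pairwise_mono[OF pairwise_subset[OF C(3) I(1)]]) (auto simp: disjnt_def)
      then have un: "(g has_integral (\<Sum>i\<in>I. integral (cball i (x i)) g)) (\<Union>i\<in>I. cball i (x i))"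
        using I(2) by (intro has_integral_UN integrable_integral) (auto simp: cball_eq_atLeastAtMost int)
      \<comment> \<open>Centres lie in one period and radii are at most pi, so three whole periods
        contain every interval.\<close>
      moreover have "(\<Union>i\<in>I. cball i (x i)) \<subseteq> {-2*pi..4*pi}"
        
      proof
        fix y assume "y \<in> (\<Union>i\<in>I. cball i (x i))"
        then obtain i where i: "i \<in> I" "i - x i \<le> y" "y \<le> i + x i"
          by (auto simp: cball_eq_atLeastAtMost)
        then show "y \<in> {-2*pi..4*pi}"
          using x(2)[OF IE[OF i(1)]] IE[OF i(1)] unfolding E_iff by auto
      qed
      ultimately show ?thesis
        using integrable_integral[OF int[of "-2*pi" "4*pi"]] g0 by (intro has_integral_subset_le) auto
    qed
    also have "integral {-2*pi..4*pi} g = 3 * integral {0..2*pi} g"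
      by (rule integral_periodic_triple[OF contg per])
    also have "integral {0..2*pi} g = 2 * pi * Re (poly q 0)"
      using circle_mean_Re_poly[of q] by (simp add: circle_mean_def g_def[abs_def] field_simps)
    finally show ?thesis using \<open>0 < \<kappa>\<close> by (simp add: mult_left_mono field_simps)
  qed
  have fm: "\<And>i. cball i (5 * x i) \<in> fmeasurable lborel"
    by (intro fmeasurable_compact) simp
  have "open E"
    unfolding E_def by (intro open_radial_superlevel continuous_intros)
  then have "measure lborel E \<le> measure lborel (\<Union>i\<in>C. cball i (5 * x i))"
    by (intro measure_mono_fmeasurable[OF C(4)] fmeasurable_UN_bound[OF C(1) fm bound]) auto
  also have "\<dots> \<le> ?B"
    by (rule measure_UN_bound[OF C(1) fm bound])
  finally show ?thesis unfolding E_def .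
qed

text \<open>Cutting the radius at s < 1 reduces to the dilation of F by s, which has a polynomial
  majorant of its square; the bound is uniform in s and passes to the increasing union.\<close>

lemma radial_maximal_weak_type:
  assumes F: "F holomorphic_on ball 0 1" "\<And>s. 0 \<le> s \<Longrightarrow> s < 1 \<Longrightarrow> h2_mean F s \<le> B" and "0 < \<kappa>"
  shows "measure lborel {t \<in> {0<..<2*pi}. \<exists>r. 0 \<le> r \<and> r < 1 \<and> \<kappa> < (cmod (F (of_real r * cis t)))\<^sup>2}
    \<le> 30 * pi / \<kappa> * B" (is "measure lborel ?E \<le> _")
proof -
  define E where "E s = {t \<in> {0<..<2*pi}. \<exists>r. 0 \<le> r \<and> r < s \<and> \<kappa> < (cmod (F (of_real r * cis t)))\<^sup>2}" for s
  define s where "s = radii"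
  have s: "0 < s n" "s n < 1" for n by (auto simp: s_def radii_bounds)
  have mono: "s m \<le> s n" if "m \<le> n" for m n
    using that by (auto simp: s_def radii_def intro!: le_imp_inverse_le)
  have E_eq: "E x = {t \<in> {0<..<2*pi}. \<exists>r. 0 \<le> r \<and> r < 1 \<and> \<kappa> < (cmod (F (of_real x * (of_real r * cis t))))\<^sup>2}" (is "_ = ?E' x")
    if x: "0 < x" for x
  proof (intro equalityI subsetI)
    fix t assume "t \<in> E x"
    then obtain r where r: "t \<in> {0<..<2*pi}" "0 \<le> r" "r < x" "\<kappa> < (cmod (F (of_real r * cis t)))\<^sup>2"
      by (auto simp: E_def)
    have "of_real x * (of_real (r / x) * cis t) = of_real r * cis t" using x by simp
    then show "t \<in> ?E' x"
      using r x by (intro CollectI conjI exI[of _ "r / x"]) auto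
  next
    fix t assume "t \<in> ?E' x"
    then obtain r where r: "t \<in> {0<..<2*pi}" "0 \<le> r" "r < 1" "\<kappa> < (cmod (F (of_real x * (of_real r * cis t))))\<^sup>2"
      by auto
    then show "t \<in> E x"
      unfolding E_def using x by (intro CollectI conjI exI[of _ "x * r"]) (auto simp: mult.assoc)
  qed
  have ivl: "{0<..<2*pi} \<in> fmeasurable lborel" by (auto intro!: fmeasurableI)
  have fm: "E (s n) \<in> fmeasurable lborel" for n
  proof (rule fmeasurableI2[OF ivl])
    have "open (E (s n))"
      unfolding E_eq[OF s(1)] using s[of n]
      by (intro open_radial_superlevel continuous_intros continuous_on_dilate[OF F(1)]) auto
    then show "E (s n) \<in> sets lborel" by simp
  qed (auto simp: E_def)
  have bound: "measure lborel (E (s n)) \<le> 30 * pi / \<kappa> * B" for n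
  proof (rule le_of_forall_pos_mult)
    show "0 < 30 * pi / \<kappa>" using \<open>0 < \<kappa>\<close> by simp
    fix e :: real assume "0 < e"
    obtain R where R: "1 < R" "(\<lambda>z. F (of_real (s n) * z)) holomorphic_on ball 0 R"
      using holomorphic_on_dilate[OF F(1), of "s n"] s[of n] by auto
    obtain q where q: "\<And>z. cmod z \<le> 1 \<Longrightarrow> (cmod (F (of_real (s n) * z)))\<^sup>2 \<le> Re (poly q z)"
      "\<And>z. cmod z = 1 \<Longrightarrow> Re (poly q z) \<le> (cmod (F (of_real (s n) * z)))\<^sup>2 + e"
      using holomorphic_square_poly_majorant[OF R(2,1) \<open>0 < e\<close>] by metis
    let ?Q = "{t \<in> {0<..<2*pi}. \<exists>r. 0 \<le> r \<and> r < 1 \<and> \<kappa> < Re (poly q (of_real r * cis t))}"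
    have "open ?Q" by (intro open_radial_superlevel continuous_intros)
    then have "?Q \<in> sets lborel" unfolding sets_lborel by (rule borel_open)
    then have "?Q \<in> fmeasurable lborel"
      by (rule fmeasurableI2[OF ivl Collect_restrict])
    moreover have "E (s n) \<subseteq> ?Q"
    proof
      fix t assume "t \<in> E (s n)"
      then obtain r where r: "t \<in> {0<..<2*pi}" "0 \<le> r" "r < 1"
        "\<kappa> < (cmod (F (of_real (s n) * (of_real r * cis t))))\<^sup>2"
        unfolding E_eq[OF s(1)] by auto
      moreover have "(cmod (F (of_real (s n) * (of_real r * cis t))))\<^sup>2 \<le> Re (poly q (of_real r * cis t))"
        by (rule q(1)) (use r in \<open>auto simp: norm_mult\<close>)
      ultimately show "t \<in> ?Q" by force
    qed
    ultimately have "measure lborel (E (s n)) \<le> measure lborel ?Q"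
      using fmeasurableD[OF fm] by (intro measure_mono_fmeasurable)
    also have "\<dots> \<le> 30 * pi / \<kappa> * Re (poly q 0)"
      by (rule radial_maximal_weak_type_poly[OF _ \<open>0 < \<kappa>\<close>]) (rule order_trans[OF _ q(1)], auto)
    also have "\<dots> \<le> 30 * pi / \<kappa> * (B + e)"
    proof (rule mult_left_mono)
      have cont: "continuous_on (sphere 0 1) (\<lambda>z. F (of_real (s n) * z))"
        using s[of n] by (intro continuous_on_dilate[OF F(1)]) auto
      have "Re (poly q 0) \<le> circle_mean (\<lambda>z. (cmod (F (of_real (s n) * z)))\<^sup>2 + e)"
        unfolding circle_mean_Re_poly[symmetric]
        by (intro circle_mean_mono continuous_intros cont q(2))
      also have "\<dots> = h2_mean F (s n) + e"
        using s[of n] by (subst circle_mean_add) (auto intro!: continuous_intros cont simp: h2_mean_eq[OF F(1)])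
      finally show "Re (poly q 0) \<le> B + e" using F(2)[of "s n"] s[of n] by linarith
    qed (use \<open>0 < \<kappa>\<close> in simp)
    finally show "measure lborel (E (s n)) \<le> 30 * pi / \<kappa> * (B + e)" .
  qed
  have "?E = (\<Union>n. E (s n))"
  proof (intro equalityI subsetI)
    fix t assume "t \<in> ?E"
    then obtain r where r: "t \<in> {0<..<2*pi}" "0 \<le> r" "r < 1" "\<kappa> < (cmod (F (of_real r * cis t)))\<^sup>2"
      by auto
    obtain n where "r < s n"
      using eventually_happens[OF radii_eventually_gt[OF r(3)]] by (auto simp: s_def)
    then show "t \<in> (\<Union>n. E (s n))" using r by (auto simp: E_def)
  next
    fix t assume "t \<in> (\<Union>n. E (s n))"
    then show "t \<in> ?E" using s(2) less_trans by (fastforce simp: E_def)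
  qed
  moreover have "measure lborel (\<Union>i\<le>n. E (s i)) \<le> 30 * pi / \<kappa> * B" for n
  proof -
    have "E (s i) \<subseteq> E (s n)" if "i \<le> n" for i
      using mono[OF that] by (fastforce simp: E_def)
    then have "(\<Union>i\<le>n. E (s i)) = E (s n)" by auto
    then show ?thesis using bound by simp
  qed
  ultimately show ?thesis using measure_countable_Union_le[OF fm] by simp
qed

section \<open>Existence of radial limits almost everywhere\<close>

lemma cauchy_at_left_imp_limit:
  fixes f :: "real \<Rightarrow> 'a::complete_space"
  assumes "\<And>e. 0 < e \<Longrightarrow> \<exists>d<1. \<forall>r r'. d < r \<and> r < 1 \<and> d < r' \<and> r' < 1 \<longrightarrow> dist (f r) (f r') < e"
  shows "\<exists>L. (f \<longlongrightarrow> L) (at_left 1)"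
proof -
  define x where "x n = 1 - inverse (real (Suc n))" for n
  have x1: "x n < 1" for n by (simp add: x_def)
  have "x \<longlonglongrightarrow> 1 - 0"
    unfolding x_def by (intro tendsto_intros LIMSEQ_inverse_real_of_nat)
  then have ev: "eventually (\<lambda>n. d < x n) sequentially" if "d < 1" for d
    using order_tendstoD(1)[of x 1] that by simp
  have "Cauchy (\<lambda>n. f (x n))"
  proof (rule metric_CauchyI)
    fix e :: real assume "0 < e"
    then obtain d where d: "d < 1" "\<And>r r'. d < r \<Longrightarrow> r < 1 \<Longrightarrow> d < r' \<Longrightarrow> r' < 1 \<Longrightarrow> dist (f r) (f r') < e"
      using assms by meson
    obtain N where "\<And>n. n \<ge> N \<Longrightarrow> d < x n" using ev[OF d(1)] by (auto simp: eventually_sequentially)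
    then show "\<exists>M. \<forall>m\<ge>M. \<forall>n\<ge>M. dist (f (x m)) (f (x n)) < e" using d(2) x1 by blast
  qed
  then obtain L where L: "(\<lambda>n. f (x n)) \<longlonglongrightarrow> L"
    using Cauchy_convergent convergent_def by blast
  have "(f \<longlongrightarrow> L) (at_left 1)"
  proof (rule tendstoI)
    fix e :: real assume "0 < e"
    then obtain d where d: "d < 1" "\<And>r r'. d < r \<Longrightarrow> r < 1 \<Longrightarrow> d < r' \<Longrightarrow> r' < 1 \<Longrightarrow> dist (f r) (f r') < e / 2"
      using assms[of "e / 2"] by (meson half_gt_zero)
    have "dist (f r) L < e" if "d < r" "r < 1" for r
    proof -
      have "eventually (\<lambda>n. dist (f r) (f (x n)) \<le> e / 2) sequentially"
        using ev[OF d(1)] by eventually_elim (use d(2) that x1 in \<open>auto intro: less_imp_le\<close>)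
      then have "dist (f r) L \<le> e / 2"
        by (intro tendsto_upperbound[OF tendsto_dist[OF tendsto_const L]]) auto
      then show ?thesis using \<open>0 < e\<close> by simp
    qed
    then show "\<forall>\<^sub>F r in at_left 1. dist (f r) L < e"
      using d(1) eventually_at_left_field by blast
  qed
  then show ?thesis by blast
qed

text \<open>Take \<rho> with mean within e of the supremum A. In the identity for the difference,
  the mean at \<rho> s is absorbed by one of the two means at sqrt \<rho> s, and what remains is at
  most A minus the mean at \<rho>.\<close>

lemma h2_mean_dilate_diff_small:
  assumes f: "f holomorphic_on ball 0 1" "\<And>s. 0 \<le> s \<Longrightarrow> s < 1 \<Longrightarrow> h2_mean f s \<le> B" and "0 < e"
  obtains \<rho> where "0 \<le> \<rho>" "\<rho> < 1"
    "\<And>s. 0 \<le> s \<Longrightarrow> s < 1 \<Longrightarrow> h2_mean (\<lambda>z. f z - f (of_real \<rho> * z)) s \<le> e"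
proof -
  define A where "A = (SUP r\<in>{0..<1}. h2_mean f r)"
  have bdd: "bdd_above (h2_mean f ` {0..<1})" using f(2) by (auto intro!: bdd_aboveI[of _ B])
  have le_A: "h2_mean f s \<le> A" if "0 \<le> s" "s < 1" for s
    unfolding A_def using that by (intro cSUP_upper bdd) auto
  obtain \<rho> where \<rho>: "0 \<le> \<rho>" "\<rho> < 1" "A - e < h2_mean f \<rho>"
  proof -
    have "\<not> (\<forall>r\<in>{0..<1}. h2_mean f r \<le> A - e)"
    proof
      assume "\<forall>r\<in>{0..<1}. h2_mean f r \<le> A - e"
      then have "(SUP r\<in>{0..<1}. h2_mean f r) \<le> A - e" by (intro cSUP_least) auto
      then show False using \<open>0 < e\<close> by (simp add: A_def)
    qed
    then show thesis using that by force
  qed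
  show thesis
  proof (rule that[OF \<rho>(1,2)])
    fix s :: real assume s: "0 \<le> s" "s < 1"
    have sq: "\<rho> \<le> sqrt \<rho>" "sqrt \<rho> < 1" "0 \<le> sqrt \<rho>"
    proof -
      have "sqrt \<rho> * sqrt \<rho> \<le> sqrt \<rho> * 1" using \<rho> by (intro mult_left_mono) auto
      then show "\<rho> \<le> sqrt \<rho>" using \<rho> by simp
    qed (use \<rho> in auto)
    \<comment> \<open>Enlarging s to at least sqrt \<rho> guarantees sqrt \<rho> s' \<ge> \<rho>, so
      monotonicity reaches the radius \<rho>.\<close>
    define s' where "s' = max s (sqrt \<rho>)"
    have s': "0 \<le> s'" "s' < 1" "s \<le> s'" "sqrt \<rho> \<le> s'" using s sq by (auto simp: s'_def)
    have "\<rho> = sqrt \<rho> * sqrt \<rho>" using \<rho> by simp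
    also have "\<dots> \<le> sqrt \<rho> * s'" using s' sq by (intro mult_left_mono) auto
    finally have le1: "\<rho> \<le> sqrt \<rho> * s'" .
    have le2: "\<rho> * s' \<le> sqrt \<rho> * s'" using s' sq by (intro mult_right_mono) auto
    have "sqrt \<rho> * s' \<le> sqrt \<rho> * 1" using s' sq by (intro mult_left_mono) auto
    then have lt: "sqrt \<rho> * s' < 1" using sq by linarith
    have "(\<lambda>z. f z - f (of_real \<rho> * z)) holomorphic_on ball 0 1"
      using \<rho> by (intro holomorphic_intros f holomorphic_on_compose_scale) auto
    then have "h2_mean (\<lambda>z. f z - f (of_real \<rho> * z)) s \<le> h2_mean (\<lambda>z. f z - f (of_real \<rho> * z)) s'"
      using s s' by (intro h2_mean_mono)
    also have "\<dots> = h2_mean f s' + h2_mean f (\<rho> * s') - 2 * h2_mean f (sqrt \<rho> * s')"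
      using s' \<rho> by (intro h2_mean_dilate_diff f) auto
    also have "h2_mean f (\<rho> * s') \<le> h2_mean f (sqrt \<rho> * s')"
      using le2 lt \<rho> s' by (intro h2_mean_mono f) auto
    also have "h2_mean f s' \<le> A" using s' by (intro le_A)
    finally have "h2_mean (\<lambda>z. f z - f (of_real \<rho> * z)) s \<le> A - h2_mean f (sqrt \<rho> * s')" by simp
    also have "h2_mean f \<rho> \<le> h2_mean f (sqrt \<rho> * s')"
      using le1 lt \<rho> by (intro h2_mean_mono f) auto
    then have "A - h2_mean f (sqrt \<rho> * s') \<le> e" using \<rho>(3) by simp
    finally show "h2_mean (\<lambda>z. f z - f (of_real \<rho> * z)) s \<le> e" .
  qed
qed

text \<open>The maximal-function argument: a dilation of f is continuous up to the circle, and the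
  remainder is uniformly small along a radius except for angles in a set of small measure. In
  \<open>E m j\<close> the index m fixes the tolerance and j the quality of the approximation; for
  fixed m the measures tend to 0 in j.\<close>

theorem fatou_radial_limits:
  assumes f: "f holomorphic_on ball 0 1" "\<And>s. 0 \<le> s \<Longrightarrow> s < 1 \<Longrightarrow> h2_mean f s \<le> B"
  shows "AE t in lborel. t \<in> {0..2*pi} \<longrightarrow> (\<exists>L. ((\<lambda>r. f (of_real r * cis t)) \<longlongrightarrow> L) (at_left 1))"
proof -
  have "\<exists>\<rho>. 0 \<le> \<rho> \<and> \<rho> < 1 \<and> (\<forall>s. 0 \<le> s \<longrightarrow> s < 1 \<longrightarrow> h2_mean (\<lambda>z. f z - f (of_real \<rho> * z)) s \<le> inverse (real (Suc j)))" for j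
    by (rule h2_mean_dilate_diff_small[OF f, of "inverse (real (Suc j))"]) auto
  then obtain \<rho> where \<rho>: "\<And>j. 0 \<le> \<rho> j" "\<And>j. \<rho> j < 1"
    "\<And>j s. 0 \<le> s \<Longrightarrow> s < 1 \<Longrightarrow> h2_mean (\<lambda>z. f z - f (of_real (\<rho> j) * z)) s \<le> inverse (real (Suc j))"
    by metis
  have hol: "(\<lambda>z. f z - f (of_real (\<rho> j) * z)) holomorphic_on ball 0 1" for j
    by (intro holomorphic_intros f holomorphic_on_compose_scale \<rho> less_imp_le)
  define E where "E m j = {t \<in> {0<..<2*pi}. \<exists>r. 0 \<le> r \<and> r < 1 \<and>
    inverse (real (Suc m)) < (cmod (f (of_real r * cis t) - f (of_real (\<rho> j) * (of_real r * cis t))))\<^sup>2}" for m j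
  have E_meas: "measure lborel (E m j) \<le> 30 * pi / inverse (real (Suc m)) * inverse (real (Suc j))" for m j
    unfolding E_def by (rule radial_maximal_weak_type[OF hol \<rho>(3)]) auto
  have "open (E m j)" for m j
    unfolding E_def
    by (intro open_radial_superlevel continuous_intros holomorphic_on_imp_continuous_on[OF hol])
  then have E_sets: "E m j \<in> sets lborel" for m j by simp
  have ivl: "{0<..<2*pi} \<in> fmeasurable lborel" by (auto intro!: fmeasurableI)
  have E_fm: "E m j \<in> fmeasurable lborel" for m j
    by (rule fmeasurableI2[OF ivl _ E_sets]) (auto simp: E_def)
  have "(\<Inter>j. E m j) \<in> null_sets lborel" for m
  proof -
    have sets: "(\<Inter>j. E m j) \<in> sets lborel" using E_sets by (intro sets.countable_INT') auto
    have fm: "(\<Inter>j. E m j) \<in> fmeasurable lborel"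
      by (rule fmeasurableI2[OF E_fm[of m 0] _ sets]) auto
    have "measure lborel (\<Inter>j. E m j) \<le> 30 * pi / inverse (real (Suc m)) * inverse (real (Suc j))" for j
      using measure_mono_fmeasurable[OF _ sets E_fm[of m j]] E_meas[of m j] by (meson INT_lower UNIV_I order_trans)
    moreover have "(\<lambda>j. 30 * pi / inverse (real (Suc m)) * inverse (real (Suc j))) \<longlonglongrightarrow> 30 * pi / inverse (real (Suc m)) * 0"
      by (intro tendsto_intros LIMSEQ_inverse_real_of_nat)
    ultimately have "measure lborel (\<Inter>j. E m j) \<le> 0"
      using LIMSEQ_le_const by (metis (no_types, lifting) mult_zero_right)
    then have "measure lborel (\<Inter>j. E m j) = 0" using measure_nonneg by (metis order_antisym)
    then show ?thesis using fm sets by (simp add: null_sets_def emeasure_eq_measure2)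
  qed
  then have N: "(\<Union>m. \<Inter>j. E m j) \<in> null_sets lborel" by (intro null_sets_UN)
  have "{0, 2*pi} \<in> null_sets lborel" by (intro finite_imp_null_set_lborel) auto
  then have "(\<Union>m. \<Inter>j. E m j) \<union> {0, 2*pi} \<in> null_sets lborel" using N by blast
  then show ?thesis
  proof (rule AE_I')
    show "{t \<in> space lborel. \<not> (t \<in> {0..2*pi} \<longrightarrow> (\<exists>L. ((\<lambda>r. f (of_real r * cis t)) \<longlongrightarrow> L) (at_left 1)))}
        \<subseteq> (\<Union>m. \<Inter>j. E m j) \<union> {0, 2*pi}"
    proof (rule subsetI, rule ccontr)
      fix t assume t1: "t \<in> {t \<in> space lborel. \<not> (t \<in> {0..2*pi} \<longrightarrow> (\<exists>L. ((\<lambda>r. f (of_real r * cis t)) \<longlongrightarrow> L) (at_left 1)))}"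
        and t2: "t \<notin> (\<Union>m. \<Inter>j. E m j) \<union> {0, 2*pi}"
      have "\<exists>L. ((\<lambda>r. f (of_real r * cis t)) \<longlongrightarrow> L) (at_left 1)"
      proof (rule cauchy_at_left_imp_limit)
        fix e :: real assume "0 < e"
        then have "0 < (e / 4)\<^sup>2" by simp
        \<comment> \<open>\<open>E m j\<close> compares squared moduli, hence the square. The four
          quarters of e are two approximation errors and two distances of the dilated function from
          its limit.\<close>
        then obtain m where m: "inverse (real (Suc m)) < (e / 4)\<^sup>2" using reals_Archimedean by blast
        obtain j where j: "t \<notin> E m j" using t2 by blast
        have "0 < t" "t < 2*pi" using t1 t2 by auto
        have near: "cmod (f (of_real r * cis t) - f (of_real (\<rho> j) * (of_real r * cis t))) < e / 4" if "0 \<le> r" "r < 1" for r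
        proof -
          have "(cmod (f (of_real r * cis t) - f (of_real (\<rho> j) * (of_real r * cis t))))\<^sup>2 \<le> inverse (real (Suc m))"
            using j that \<open>0 < t\<close> \<open>t < 2*pi\<close> by (force simp: E_def)
          then show ?thesis using m \<open>0 < e\<close> by (meson le_less_trans power2_less_imp_less less_imp_le zero_less_divide_iff zero_less_numeral)
        qed
        define h where "h r = f (of_real (\<rho> j) * (of_real r * cis t))" for r :: real
        have "continuous_on (ball 0 1) f" using f(1) holomorphic_on_imp_continuous_on by blast
        then have "isCont f (of_real (\<rho> j) * cis t)"
          using \<rho>[of j] by (simp add: continuous_on_eq_continuous_at norm_mult)
        moreover have "((\<lambda>r. of_real (\<rho> j) * (of_real r * cis t)) \<longlongrightarrow> of_real (\<rho> j) * (of_real 1 * cis t)) (at_left 1)"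
          by (intro tendsto_intros)
        ultimately have "(h \<longlongrightarrow> f (of_real (\<rho> j) * cis t)) (at_left 1)"
          unfolding h_def using isCont_tendsto_compose by force
        then have "\<forall>\<^sub>F r in at_left 1. dist (h r) (f (of_real (\<rho> j) * cis t)) < e / 4"
          using \<open>0 < e\<close> by (intro tendstoD) auto
        then obtain d where d: "d < 1" "\<And>r. d < r \<Longrightarrow> r < 1 \<Longrightarrow> dist (h r) (f (of_real (\<rho> j) * cis t)) < e / 4"
          unfolding eventually_at_left_field by auto
        show "\<exists>d<1. \<forall>r r'. d < r \<and> r < 1 \<and> d < r' \<and> r' < 1 \<longrightarrow>
            dist (f (of_real r * cis t)) (f (of_real r' * cis t)) < e"
        proof (intro exI[of _ "max d 0"] conjI allI impI)
          fix r r' assume r: "max d 0 < r \<and> r < 1 \<and> max d 0 < r' \<and> r' < 1"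
          have "dist (f (of_real r * cis t)) (h r) < e / 4" "dist (f (of_real r' * cis t)) (h r') < e / 4"
            using near[of r] near[of r'] r by (auto simp: dist_norm h_def)
          moreover have "dist (h r) (f (of_real (\<rho> j) * cis t)) < e / 4" "dist (h r') (f (of_real (\<rho> j) * cis t)) < e / 4"
            using d(2)[of r] d(2)[of r'] r by auto
          ultimately show "dist (f (of_real r * cis t)) (f (of_real r' * cis t)) < e"
            by metric
        qed (use d in auto)
      qed
      then show False using t1 by simp
    qed
  qed
qed

section \<open>The boundary condition in terms of powers\<close>

lemma borel_measurable_circle:
  assumes "f holomorphic_on ball 0 1" "0 \<le> r" "r < 1"
  shows "(\<lambda>t. f (of_real r * cis t)) \<in> borel_measurable borel"
  by (intro borel_measurable_continuous_onI)
     (rule continuous_on_circle_cis[of "\<lambda>z. f (of_real r * z)"], rule continuous_on_dilate[OF assms], auto)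

lemma h2_mean_power_eq:
  "h2_mean (\<lambda>z. \<phi> z ^ k) r = (1 / (2 * pi)) *
    (LINT t|lborel. indicator {0..2*pi} t * ((cmod (\<phi> (of_real r * cis t)))\<^sup>2) ^ k)"
  by (simp add: h2_mean_def set_lebesgue_integral_def norm_power power_mult[symmetric] mult.commute)

text \<open>At a unimodular angle the k-th power of |\<phi>|^2 tends to 1 along the radius for every
  k, so the angle lies in all \<open>E k\<close>. Fatou's lemma bounds the measure of
  \<open>E k\<close> by 2 pi times the supremum of the k-th means.\<close>

lemma power_means_vanish_imp_AE:
  assumes \<phi>: "\<phi> holomorphic_on ball 0 1"
    and vanish: "\<And>e. 0 < e \<Longrightarrow> \<exists>k. \<forall>r. 0 \<le> r \<longrightarrow> r < 1 \<longrightarrow> h2_mean (\<lambda>z. \<phi> z ^ k) r \<le> e"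
  shows "AE t in lborel. t \<in> {0..2*pi} \<longrightarrow> \<not> radial_unimodular \<phi> t"
proof -
  define u where "u k n t = ennreal (indicator {0..2*pi} t * ((cmod (\<phi> (of_real (radii n) * cis t)))\<^sup>2) ^ k)" for k n t
  define E where "E k = {t \<in> space lborel. 1 \<le> liminf (\<lambda>n. u k n t)}" for k
  have meas: "(\<lambda>t. cmod (\<phi> (of_real (radii n) * cis t))) \<in> borel_measurable borel" for n
    using borel_measurable_circle[OF \<phi>, of "radii n"] radii_bounds[of n] by simp
  have u_meas [measurable]: "u k n \<in> borel_measurable lborel" for k n
    unfolding u_def using meas[of n] by measurable
  have E_sets [measurable]: "E k \<in> sets lborel" for k
    unfolding E_def by measurable
  have u_int: "(\<integral>\<^sup>+t. u k n t \<partial>lborel) = ennreal (2 * pi * h2_mean (\<lambda>z. \<phi> z ^ k) (radii n))" for k n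
  proof -
    have "continuous_on {0..2*pi} (\<lambda>t. ((cmod (\<phi> (of_real (radii n) * cis t)))\<^sup>2) ^ k)"
      using radii_bounds[of n]
      by (intro continuous_intros continuous_on_circle_cis[of "\<lambda>z. \<phi> (of_real (radii n) * z)"] continuous_on_dilate[OF \<phi>]) auto
    then have "set_integrable lborel {0..2*pi} (\<lambda>t. ((cmod (\<phi> (of_real (radii n) * cis t)))\<^sup>2) ^ k)"
      by (rule borel_integrable_atLeastAtMost')
    then have "integrable lborel (\<lambda>t. indicator {0..2*pi} t * ((cmod (\<phi> (of_real (radii n) * cis t)))\<^sup>2) ^ k)"
      by (simp add: set_integrable_def)
    then show ?thesis
      unfolding u_def by (subst nn_integral_eq_integral) (auto simp: h2_mean_power_eq)
  qed
  have small: "\<exists>k. emeasure lborel (E k) \<le> ennreal e" if "0 < e" for e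
  proof -
    have "0 < e / (2 * pi)" using that by simp
    then obtain k where k: "\<And>r. 0 \<le> r \<Longrightarrow> r < 1 \<Longrightarrow> h2_mean (\<lambda>z. \<phi> z ^ k) r \<le> e / (2 * pi)"
      using vanish by meson
    have "emeasure lborel (E k) = (\<integral>\<^sup>+t. indicator (E k) t \<partial>lborel)"
      by (rule nn_integral_indicator[OF E_sets, symmetric])
    also have "\<dots> \<le> (\<integral>\<^sup>+t. liminf (\<lambda>n. u k n t) \<partial>lborel)"
      by (intro nn_integral_mono) (auto simp: E_def split: split_indicator)
    also have "\<dots> \<le> liminf (\<lambda>n. \<integral>\<^sup>+t. u k n t \<partial>lborel)"
      by (rule nn_integral_liminf) simp
    also have "\<dots> \<le> liminf (\<lambda>n. ennreal e)"
    proof (intro Liminf_mono always_eventually allI)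
      fix n
      have "2 * pi * h2_mean (\<lambda>z. \<phi> z ^ k) (radii n) \<le> 2 * pi * (e / (2 * pi))"
        using k[of "radii n"] radii_bounds[of n] by (intro mult_left_mono) auto
      then show "(\<integral>\<^sup>+t. u k n t \<partial>lborel) \<le> ennreal e"
        unfolding u_int by (intro ennreal_leI) simp
    qed
    also have "\<dots> = ennreal e" by (simp add: Liminf_const)
    finally show ?thesis by blast
  qed
  have "emeasure lborel (\<Inter>k. E k) \<le> 0"
  proof (rule ennreal_le_epsilon)
    fix e :: real assume "0 < e"
    then obtain k where k: "emeasure lborel (E k) \<le> ennreal e" using small by blast
    have "emeasure lborel (\<Inter>k. E k) \<le> emeasure lborel (E k)" by (intro emeasure_mono[OF _ E_sets]) auto
    then show "emeasure lborel (\<Inter>k. E k) \<le> 0 + ennreal e" using k by simp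
  qed
  moreover have "(\<Inter>k. E k) \<in> sets lborel" by measurable
  ultimately have "(\<Inter>k. E k) \<in> null_sets lborel" by (intro null_setsI) simp_all
  then show ?thesis
  proof (rule AE_I')
    show "{t \<in> space lborel. \<not> (t \<in> {0..2*pi} \<longrightarrow> \<not> radial_unimodular \<phi> t)} \<subseteq> (\<Inter>k. E k)"
    proof clarsimp
      fix t k assume t: "0 \<le> t" "t \<le> 2 * pi" "radial_unimodular \<phi> t"
      then obtain L where L: "cmod L = 1" "((\<lambda>r. \<phi> (of_real r * cis t)) \<longlongrightarrow> L) (at_left 1)"
        by (auto simp: radial_unimodular_def)
      have "(\<lambda>n. \<phi> (of_real (radii n) * cis t)) \<longlonglongrightarrow> L"
        by (rule filterlim_compose[OF L(2) radii_at_left])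
      then have "(\<lambda>n. u k n t) \<longlonglongrightarrow> ennreal (indicator {0..2*pi} t * ((cmod L)\<^sup>2) ^ k)"
        unfolding u_def by (intro tendsto_intros)
      then have "(\<lambda>n. u k n t) \<longlonglongrightarrow> 1" using t L(1) by simp
      then show "t \<in> E k" by (simp add: E_def lim_imp_Liminf)
    qed
  qed
qed

lemma AE_imp_power_means_vanish:
  assumes \<phi>: "\<phi> holomorphic_on ball 0 1" "\<phi> ` ball 0 1 \<subseteq> ball 0 1"
    and ae: "AE t in lborel. t \<in> {0..2*pi} \<longrightarrow> \<not> radial_unimodular \<phi> t" and "0 < e"
  shows "\<exists>k. \<forall>r. 0 \<le> r \<longrightarrow> r < 1 \<longrightarrow> h2_mean (\<lambda>z. \<phi> z ^ k) r \<le> e"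
proof -
  have \<phi>1: "cmod (\<phi> z) < 1" if "cmod z < 1" for z
    using \<phi>(2) that by (auto simp: image_subset_iff)
  have circ: "cmod (\<phi> (of_real r * cis t)) < 1" if "0 \<le> r" "r < 1" for r t
    by (rule \<phi>1) (use that in \<open>simp add: norm_mult\<close>)
  have "h2_mean \<phi> s \<le> 1" if "0 \<le> s" "s < 1" for s
  proof -
    have "h2_mean \<phi> s \<le> circle_mean (\<lambda>z. 1)"
      unfolding h2_mean_eq[OF \<phi>(1) that]
    proof (intro circle_mean_mono continuous_intros continuous_on_dilate[OF \<phi>(1) that])
      fix z :: complex assume "cmod z = 1"
      then have "cmod (\<phi> (of_real s * z)) < 1" using that by (intro \<phi>1) (simp add: norm_mult)
      then show "(cmod (\<phi> (of_real s * z)))\<^sup>2 \<le> 1" by (simp add: power_le_one less_imp_le)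
    qed auto
    then show ?thesis by simp
  qed
  then have fatou: "AE t in lborel. t \<in> {0..2*pi} \<longrightarrow> (\<exists>L. ((\<lambda>r. \<phi> (of_real r * cis t)) \<longlongrightarrow> L) (at_left 1))"
    by (rule fatou_radial_limits[OF \<phi>(1)])
  define v where "v n t = (cmod (\<phi> (of_real (radii n) * cis t)))\<^sup>2" for n t
  \<comment> \<open>A measurable version of the squared modulus of the radial limit. Where the
    sequence diverges the value of \<open>lim\<close> is unspecified, but within [0, 2 pi] that is a
    null set.\<close>
  define \<psi> where "\<psi> t = lim (\<lambda>n. v n t)" for t
  have v_meas [measurable]: "v n \<in> borel_measurable borel" for n
    unfolding v_def using borel_measurable_circle[OF \<phi>(1), of "radii n"] radii_bounds[of n] by simp
  have \<psi>_meas [measurable]: "\<psi> \<in> borel_measurable borel"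
    unfolding \<psi>_def by measurable
  have v01: "0 \<le> v n t" "v n t \<le> 1" for n t
    using circ[of "radii n" t] radii_bounds[of n] by (auto simp: v_def power_le_one less_imp_le)
  have lim_ae: "AE t in lborel. t \<in> {0..2*pi} \<longrightarrow> (\<lambda>n. v n t) \<longlonglongrightarrow> \<psi> t \<and> 0 \<le> \<psi> t \<and> \<psi> t < 1"
    using fatou ae
  proof eventually_elim
    case (elim t)
    show ?case
    proof
      assume t: "t \<in> {0..2*pi}"
      then obtain L where L: "((\<lambda>r. \<phi> (of_real r * cis t)) \<longlongrightarrow> L) (at_left 1)"
        using elim(1) by blast
      have "(\<lambda>n. \<phi> (of_real (radii n) * cis t)) \<longlonglongrightarrow> L"
        by (rule filterlim_compose[OF L radii_at_left])
      then have lim: "(\<lambda>n. v n t) \<longlonglongrightarrow> (cmod L)\<^sup>2"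
        unfolding v_def by (intro tendsto_intros)
      then have eq: "\<psi> t = (cmod L)\<^sup>2" by (simp add: \<psi>_def limI)
      have "(cmod L)\<^sup>2 \<le> 1" by (rule LIMSEQ_le_const2[OF lim]) (use v01 in auto)
      moreover have "cmod L \<noteq> 1" using elim(2) t L by (auto simp: radial_unimodular_def)
      ultimately have "(cmod L)\<^sup>2 < 1" by (simp add: abs_square_le_1 abs_square_less_1)
      then show "(\<lambda>n. v n t) \<longlonglongrightarrow> \<psi> t \<and> 0 \<le> \<psi> t \<and> \<psi> t < 1" using lim eq by simp
    qed
  qed
  have ind: "integrable lborel (indicator {0..2*pi} :: real \<Rightarrow> real)"
    by (simp add: integrable_indicator_iff)
  \<comment> \<open>Dominated convergence is applied twice: here in the radius for a fixed power,
    afterwards in the power, where \<psi> < 1 almost everywhere forces the limit 0.\<close>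
  have lim_n: "(\<lambda>n. h2_mean (\<lambda>z. \<phi> z ^ k) (radii n)) \<longlonglongrightarrow> (1 / (2 * pi)) * (LINT t|lborel. indicator {0..2*pi} t * \<psi> t ^ k)" for k
    unfolding h2_mean_power_eq v_def[symmetric]
  proof (intro tendsto_intros integral_dominated_convergence[OF _ _ ind])
    show "AE t in lborel. (\<lambda>n. indicator {0..2*pi} t * v n t ^ k) \<longlonglongrightarrow> indicator {0..2*pi} t * \<psi> t ^ k"
      using lim_ae
    proof eventually_elim
      case (elim t)
      then show ?case
        by (cases "t \<in> {0..2*pi}") (auto intro!: tendsto_intros)
    qed
    show "AE t in lborel. norm (indicator {0..2*pi} t * v n t ^ k) \<le> indicator {0..2*pi} t" for n
      using v01 by (intro AE_I2) (auto simp: power_le_one split: split_indicator)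
  qed measurable
  have "(\<lambda>k. LINT t|lborel. indicator {0..2*pi} t * \<psi> t ^ k) \<longlonglongrightarrow> (LINT t::real|lborel. 0)"
  proof (rule integral_dominated_convergence[OF _ _ ind])
    show "AE t in lborel. (\<lambda>k. indicator {0..2*pi} t * \<psi> t ^ k) \<longlonglongrightarrow> 0"
      using lim_ae
    proof eventually_elim
      case (elim t)
      then show ?case
        by (cases "t \<in> {0..2*pi}") (auto intro!: LIMSEQ_realpow_zero)
    qed
    show "AE t in lborel. norm (indicator {0..2*pi} t * \<psi> t ^ k) \<le> indicator {0..2*pi} t" for k
      using lim_ae by eventually_elim (auto simp: power_le_one split: split_indicator)
  qed measurable
  then have "(\<lambda>k. (1 / (2 * pi)) * (LINT t|lborel. indicator {0..2*pi} t * \<psi> t ^ k)) \<longlonglongrightarrow> (1 / (2 * pi)) * 0"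
    by (intro tendsto_intros) simp
  then have "eventually (\<lambda>k. (1 / (2 * pi)) * (LINT t|lborel. indicator {0..2*pi} t * \<psi> t ^ k) < e) sequentially"
    using \<open>0 < e\<close> by (intro order_tendstoD(2)) auto
  then obtain k where k: "(1 / (2 * pi)) * (LINT t|lborel. indicator {0..2*pi} t * \<psi> t ^ k) < e"
    by (auto simp: eventually_sequentially)
  have "h2_mean (\<lambda>z. \<phi> z ^ k) r \<le> e" if r: "0 \<le> r" "r < 1" for r
  proof -
    \<comment> \<open>Means increase with the radius, so their limit bounds them at every
      radius.\<close>
    have "eventually (\<lambda>n. h2_mean (\<lambda>z. \<phi> z ^ k) r \<le> h2_mean (\<lambda>z. \<phi> z ^ k) (radii n)) sequentially"
      using radii_eventually_gt[OF r(2)]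
      by eventually_elim (use r radii_bounds in \<open>auto intro!: h2_mean_mono holomorphic_intros \<phi>\<close>)
    then have "h2_mean (\<lambda>z. \<phi> z ^ k) r \<le> (1 / (2 * pi)) * (LINT t|lborel. indicator {0..2*pi} t * \<psi> t ^ k)"
      by (intro tendsto_lowerbound[OF lim_n]) auto
    then show ?thesis using k by linarith
  qed
  then show ?thesis by blast
qed

section \<open>Necessity\<close>

lemma H2_holomorphic: "f \<in> H2 \<Longrightarrow> f holomorphic_on ball 0 1"
  by (simp add: H2_def)

lemma h2_norm_nonneg: "f \<in> H2 \<Longrightarrow> 0 \<le> h2_norm f"
  unfolding h2_norm_def H2_def
  by (auto intro!: real_sqrt_ge_zero cSUP_upper2[where x=0] h2_mean_nonneg)

lemma h2_mean_le_norm: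
  assumes "f \<in> H2" "0 \<le> s" "s < 1"
  shows "h2_mean f s \<le> (h2_norm f)\<^sup>2"
proof -
  have le: "h2_mean f s \<le> (SUP r\<in>{0..<1}. h2_mean f r)"
    using assms by (intro cSUP_upper) (auto simp: H2_def)
  then have "0 \<le> (SUP r\<in>{0..<1}. h2_mean f r)"
    using h2_mean_nonneg[of f s] by linarith
  then show ?thesis using le by (simp add: h2_norm_def)
qed

lemma h2_norm_le:
  assumes "\<And>s. 0 \<le> s \<Longrightarrow> s < 1 \<Longrightarrow> h2_mean f s \<le> c\<^sup>2" "0 \<le> c"
  shows "h2_norm f \<le> c"
proof -
  have "(SUP r\<in>{0..<1}. h2_mean f r) \<le> c\<^sup>2"
    using assms(1) by (intro cSUP_least) auto
  then have "h2_norm f \<le> sqrt (c\<^sup>2)" unfolding h2_norm_def by (rule real_sqrt_le_mono)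
  then show ?thesis using assms(2) by simp
qed

lemma H2I:
  assumes "f holomorphic_on ball 0 1" "\<And>s. 0 \<le> s \<Longrightarrow> s < 1 \<Longrightarrow> h2_mean f s \<le> B"
  shows "f \<in> H2"
  using assms by (auto simp: H2_def intro!: bdd_aboveI[of _ B])

text \<open>The affine form covers several uses: b = 0 for bounded functions, a = 0 for bounded
  multipliers, and both terms in the compactness estimate.\<close>

lemma h2_mean_le_circle:
  assumes "f holomorphic_on ball 0 1" "g holomorphic_on ball 0 1" "0 \<le> s" "s < 1"
    and "\<And>z. cmod z < 1 \<Longrightarrow> (cmod (f z))\<^sup>2 \<le> a + b * (cmod (g z))\<^sup>2"
  shows "h2_mean f s \<le> a + b * h2_mean g s"
proof -
  note cont = continuous_on_dilate[OF assms(1,3,4)] continuous_on_dilate[OF assms(2,3,4)]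
  have "h2_mean f s \<le> circle_mean (\<lambda>z. a + b * (cmod (g (of_real s * z)))\<^sup>2)"
    unfolding h2_mean_eq[OF assms(1,3,4)]
    by (intro circle_mean_mono continuous_intros cont assms(5)) (use assms(3,4) in \<open>auto simp: norm_mult\<close>)
  also have "\<dots> = a + circle_mean (\<lambda>z. b * (cmod (g (of_real s * z)))\<^sup>2)"
    by (subst circle_mean_add) (auto intro!: continuous_intros cont)
  also have "\<dots> = a + b * h2_mean g s"
    unfolding h2_mean_eq[OF assms(2-4)] by (subst circle_mean_mult_left) (auto intro!: continuous_intros cont)
  finally show ?thesis .
qed

lemma cmod_diff_square_le: "(cmod (a - b))\<^sup>2 \<le> 2 * (cmod a)\<^sup>2 + 2 * (cmod b)\<^sup>2"
proof -
  have "(cmod (a - b))\<^sup>2 \<le> (cmod a + cmod b)\<^sup>2" by (intro power_mono norm_triangle_ineq4) auto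
  also have "\<dots> \<le> 2 * (cmod a)\<^sup>2 + 2 * (cmod b)\<^sup>2"
    using sum_squares_bound[of "cmod a" "cmod b"] by (simp add: power2_sum)
  finally show ?thesis .
qed

lemma h2_mean_diff_le:
  assumes "f holomorphic_on ball 0 1" "g holomorphic_on ball 0 1" "0 \<le> s" "s < 1"
  shows "h2_mean (\<lambda>z. f z - g z) s \<le> 2 * h2_mean f s + 2 * h2_mean g s"
proof -
  note cont = continuous_on_dilate[OF assms(1,3,4)] continuous_on_dilate[OF assms(2,3,4)]
  have fg: "(\<lambda>z. f z - g z) holomorphic_on ball 0 1" by (intro holomorphic_intros assms)
  have "h2_mean (\<lambda>z. f z - g z) s
      \<le> circle_mean (\<lambda>z. 2 * (cmod (f (of_real s * z)))\<^sup>2 + 2 * (cmod (g (of_real s * z)))\<^sup>2)"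
    unfolding h2_mean_eq[OF fg assms(3,4)]
    by (intro circle_mean_mono continuous_intros cont cmod_diff_square_le) auto
  also have "\<dots> = 2 * h2_mean f s + 2 * h2_mean g s"
    unfolding h2_mean_eq[OF assms(1,3,4)] h2_mean_eq[OF assms(2-4)]
    by (subst circle_mean_add; (subst circle_mean_mult_left)?; (subst circle_mean_mult_left)?)
       (auto intro!: continuous_intros cont)
  finally show ?thesis .
qed

lemma H2_diff:
  assumes "f \<in> H2" "g \<in> H2"
  shows "(\<lambda>z. f z - g z) \<in> H2"
proof (rule H2I)
  fix s :: real assume s: "0 \<le> s" "s < 1"
  have "h2_mean (\<lambda>z. f z - g z) s \<le> 2 * h2_mean f s + 2 * h2_mean g s"
    by (intro h2_mean_diff_le H2_holomorphic assms s)
  then show "h2_mean (\<lambda>z. f z - g z) s \<le> 2 * (h2_norm f)\<^sup>2 + 2 * (h2_norm g)\<^sup>2"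
    using h2_mean_le_norm[OF assms(1) s] h2_mean_le_norm[OF assms(2) s] by linarith
qed (intro holomorphic_intros H2_holomorphic assms)

lemma h2_mean_cong:
  assumes "\<And>z. cmod z < 1 \<Longrightarrow> f z = g z" "0 \<le> s" "s < 1"
  shows "h2_mean f s = h2_mean g s"
  using assms by (simp add: h2_mean_def norm_mult)

lemma exp_mult_le_chord:
  fixes K x :: real
  assumes "0 \<le> x" "x \<le> 1"
  shows "exp (K * x) \<le> 1 + x * exp K"
proof -
  have "exp ((1 - x) *\<^sub>R 0 + x *\<^sub>R K) \<le> (1 - x) * exp 0 + x * exp K"
    by (rule convex_onD[OF exp_convex]) (use assms in auto)
  then show ?thesis using assms by (simp add: mult.commute)
qed

text \<open>With \<open>q\<close> a harmonic majorant of \<open>\<bar>\<phi>\<^sup>k\<bar>\<^sup>2\<close>, point evaluation of \<open>w * exp (K q / 2)\<close> gains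
  the factor \<open>exp (K Re q)\<close> on the left, while on the right it only costs \<open>exp K\<close> on the part of
  the mean weighted by \<open>\<bar>\<phi>\<^sup>k\<bar>\<^sup>2\<close>.\<close>

lemma weight_lower_bound:
  fixes a K y :: real
  assumes \<phi>: "\<phi> holomorphic_on ball 0 1" "\<phi> ` ball 0 1 \<subseteq> ball 0 1"
    and w: "w holomorphic_on ball 0 1"
    and W: "\<And>s. 0 \<le> s \<Longrightarrow> s < 1 \<Longrightarrow> h2_mean w s \<le> W"
    and V: "\<And>s. 0 \<le> s \<Longrightarrow> s < 1 \<Longrightarrow> h2_mean (\<lambda>z. w z * \<phi> z ^ k) s \<le> V"
    and s0: "0 \<le> s0" "s0 < 1" "a \<le> h2_mean (\<lambda>z. \<phi> z ^ k) s0" and "0 \<le> a" "0 \<le> K"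
    and y: "cmod z0 < y" "y < 1"
  shows "(cmod (w z0))\<^sup>2 * exp (K * ((1 - y) / (1 + y) * a)) \<le> (1 + y) / (1 - y) * (exp 1 * (W + exp K * V))"
proof -
  \<comment> \<open>A dilation factor s above b exceeds s0, where the mean of the power is at least
    a, and keeps z0 / s within radius y, so the Harnack constants depend on y only.\<close>
  define b where "b = max s0 (cmod z0 / y)"
  have y0: "0 < y" using y norm_ge_zero[of z0] by linarith
  have "b < 1" using s0 y y0 by (simp add: b_def)
  then obtain s where s: "b < s" "s < 1" using dense by blast
  have s': "0 \<le> s0" "s0 < s" "0 < s" "cmod z0 / y < s" using s s0 by (auto simp: b_def)
  define z1 where "z1 = z0 / of_real s"
  have z1: "cmod z1 \<le> y" "of_real s * z1 = z0"
    using s' y0 by (auto simp: z1_def norm_divide field_simps)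
  have z1': "cmod z1 < 1" using z1 y by simp
  have \<phi>k: "(\<lambda>z. \<phi> z ^ k) holomorphic_on ball 0 1" by (intro holomorphic_intros \<phi>)
  have wk: "(\<lambda>z. w z * \<phi> z ^ k) holomorphic_on ball 0 1" by (intro holomorphic_intros \<phi> w)
  obtain R where R: "1 < R" "(\<lambda>z. \<phi> (of_real s * z) ^ k) holomorphic_on ball 0 R"
    using holomorphic_on_dilate[OF \<phi>k, of s] s s' by auto
  obtain R' where R': "1 < R'" "(\<lambda>z. w (of_real s * z)) holomorphic_on ball 0 R'"
    using holomorphic_on_dilate[OF w, of s] s s' by auto
  \<comment> \<open>With this tolerance the majorant overshoots by at most K / (K + 1) \<le> 1 after
    multiplication by K; this is the factor exp 1 in the conclusion.\<close>
  have "0 < 1 / (K + 1)" using \<open>0 \<le> K\<close> by simp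
  from holomorphic_square_poly_majorant[OF R(2,1) this]
  obtain q where q: "\<And>z. cmod z \<le> 1 \<Longrightarrow> (cmod (\<phi> (of_real s * z) ^ k))\<^sup>2 \<le> Re (poly q z)"
    "\<And>z. cmod z = 1 \<Longrightarrow> Re (poly q z) \<le> (cmod (\<phi> (of_real s * z) ^ k))\<^sup>2 + 1 / (K + 1)"
    by metis
  have cont\<phi>: "continuous_on (sphere 0 1) (\<lambda>z. \<phi> (of_real s * z))"
    and contw: "continuous_on (sphere 0 1) (\<lambda>z. w (of_real s * z))"
    using s s' by (auto intro!: continuous_on_dilate \<phi> w)
  have "a \<le> h2_mean (\<lambda>z. \<phi> z ^ k) s"
    using s0 s s' h2_mean_mono[OF \<phi>k, of s0 s] by linarith
  also have "\<dots> = circle_mean (\<lambda>z. (cmod (\<phi> (of_real s * z) ^ k))\<^sup>2)"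
    using s s' by (intro h2_mean_eq \<phi>k) auto
  also have "\<dots> \<le> circle_mean (\<lambda>z. Re (poly q z))"
    by (intro circle_mean_mono continuous_intros cont\<phi> q(1)) auto
  also have "\<dots> = Re (poly q 0)" by (rule circle_mean_Re_poly)
  finally have aq: "a \<le> Re (poly q 0)" .
  have qpos: "0 \<le> Re (poly q z)" if "cmod z = 1" for z
    using q(1)[of z] that zero_le_power2 order_trans by (metis order_refl)
  have "(1 - y) / (1 + y) * a \<le> (1 - cmod z1) / (1 + cmod z1) * Re (poly q 0)"
    using z1 z1' y y0 aq \<open>0 \<le> a\<close> by (intro mult_mono frac_le) (auto intro: add_pos_nonneg)
  also have "\<dots> \<le> Re (poly q z1)" by (rule harnack_poly(1)[OF z1' qpos])
  finally have low: "(1 - y) / (1 + y) * a \<le> Re (poly q z1)" .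
  define H where "H z = w (of_real s * z) * exp (of_real (K / 2) * poly q z)" for z
  have H_square: "(cmod (H z))\<^sup>2 = (cmod (w (of_real s * z)))\<^sup>2 * exp (K * Re (poly q z))" for z
    by (simp add: H_def norm_mult power_mult_distrib exp_double[symmetric] mult.commute)
  have H: "H holomorphic_on ball 0 R'"
    unfolding H_def by (intro holomorphic_intros R')
  have C: "0 < (1 + y) / (1 - y)" using y y0 by simp
  have "(cmod (w z0))\<^sup>2 * exp (K * ((1 - y) / (1 + y) * a)) \<le> (cmod (H z1))\<^sup>2"
    unfolding H_square z1(2)
    by (rule mult_left_mono[OF iffD2[OF exp_le_cancel_iff mult_left_mono[OF low \<open>0 \<le> K\<close>]] zero_le_power2])
  also have "\<dots> = circle_mean (\<lambda>z. (cmod (H z1))\<^sup>2)" by simp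
  also have "\<dots> \<le> (1 + cmod z1) / (1 - cmod z1) * circle_mean (\<lambda>z. (cmod (H z))\<^sup>2)"
    by (rule circle_mean_subordinate[OF H R'(1), of "\<lambda>_. z1"]) (use z1' in auto)
  also have "\<dots> \<le> (1 + y) / (1 - y) * (exp 1 * (W + exp K * V))"
  proof (rule mult_mono)
    have "circle_mean (\<lambda>z. (cmod (H z))\<^sup>2)
        \<le> circle_mean (\<lambda>z. exp 1 * ((cmod (w (of_real s * z)))\<^sup>2 + exp K * (cmod (w (of_real s * z) * \<phi> (of_real s * z) ^ k))\<^sup>2))"
    proof (rule circle_mean_mono)
      show "continuous_on (sphere 0 1) (\<lambda>z. (cmod (H z))\<^sup>2)"
        unfolding H_def by (intro continuous_intros contw)
      fix z :: complex assume z: "cmod z = 1"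
      define x where "x = (cmod (\<phi> (of_real s * z) ^ k))\<^sup>2"
      have "of_real s * z \<in> ball 0 1" using z s s' by (simp add: norm_mult)
      then have "cmod (\<phi> (of_real s * z)) < 1" using \<phi>(2) by (auto simp: image_subset_iff)
      then have x: "0 \<le> x" "x \<le> 1" by (auto simp: x_def norm_power intro!: power_le_one)
      have "K * Re (poly q z) \<le> K * (x + 1 / (K + 1))"
        using q(2)[OF z] \<open>0 \<le> K\<close> by (intro mult_left_mono) (auto simp: x_def)
      also have "\<dots> \<le> K * x + 1" using \<open>0 \<le> K\<close> by (simp add: distrib_left)
      finally have "exp (K * Re (poly q z)) \<le> exp (K * x) * exp 1" by (simp flip: exp_add)
      also have "\<dots> \<le> (1 + x * exp K) * exp 1" by (intro mult_right_mono exp_mult_le_chord x) auto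
      finally have "(cmod (H z))\<^sup>2 \<le> (cmod (w (of_real s * z)))\<^sup>2 * ((1 + x * exp K) * exp 1)"
        unfolding H_square by (intro mult_left_mono) auto
      also have "\<dots> = exp 1 * ((cmod (w (of_real s * z)))\<^sup>2 + exp K * (cmod (w (of_real s * z) * \<phi> (of_real s * z) ^ k))\<^sup>2)"
        by (simp add: x_def norm_mult power_mult_distrib algebra_simps)
      finally show "(cmod (H z))\<^sup>2 \<le> exp 1 * ((cmod (w (of_real s * z)))\<^sup>2 + exp K * (cmod (w (of_real s * z) * \<phi> (of_real s * z) ^ k))\<^sup>2)" .
    qed (intro continuous_intros contw cont\<phi>)
    also have "\<dots> = exp 1 * (h2_mean w s + exp K * h2_mean (\<lambda>z. w z * \<phi> z ^ k) s)"
      using s s' h2_mean_eq[OF w, of s] h2_mean_eq[OF wk, of s]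
      by (simp add: circle_mean_mult_left circle_mean_add continuous_on_add continuous_on_mult_left continuous_on_power
          continuous_on_norm continuous_on_mult contw cont\<phi>)
    also have "\<dots> \<le> exp 1 * (W + exp K * V)"
      using W[of s] V[of s] s s' by (intro mult_left_mono add_mono) auto
    finally show "circle_mean (\<lambda>z. (cmod (H z))\<^sup>2) \<le> exp 1 * (W + exp K * V)" .
    have "0 \<le> circle_mean (\<lambda>z. (cmod (H z))\<^sup>2)"
      using circle_mean_mono[of "\<lambda>_. 0" "\<lambda>z. (cmod (H z))\<^sup>2"]
      by (simp add: H_def continuous_on_power continuous_on_norm continuous_on_mult contw continuous_intros)
    then show "0 \<le> circle_mean (\<lambda>z. (cmod (H z))\<^sup>2)" .
  qed (use z1 y y0 C in \<open>auto intro!: frac_le\<close>)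
  finally show ?thesis .
qed

text \<open>The monomials lie in the unit ball of H^2 and are mapped to w times the powers of
  \<phi>. If all powers had norm bounded away from 0, \<open>weight_lower_bound\<close> would hold
  with one exponent for all of them.\<close>

lemma compact_weighted_imp_power_means_vanish:
  assumes \<phi>: "\<phi> holomorphic_on ball 0 1" "\<phi> ` ball 0 1 \<subseteq> ball 0 1"
    and w: "w \<in> H2" "z0 \<in> ball 0 1" "w z0 \<noteq> 0"
    and bdd: "bounded_on_H2 (wcomp w \<phi>)" and cpt: "compact_on_H2 (wcomp w \<phi>)" and "0 < e"
  shows "\<exists>k. \<forall>r. 0 \<le> r \<longrightarrow> r < 1 \<longrightarrow> h2_mean (\<lambda>z. \<phi> z ^ k) r \<le> e"
proof (rule ccontr)
  assume "\<nexists>k. \<forall>r. 0 \<le> r \<longrightarrow> r < 1 \<longrightarrow> h2_mean (\<lambda>z. \<phi> z ^ k) r \<le> e"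
  then have large: "\<exists>r. 0 \<le> r \<and> r < 1 \<and> e \<le> h2_mean (\<lambda>z. \<phi> z ^ k) r" for k
    by (meson linear)
  have mean1: "h2_mean (\<lambda>z. z ^ n) s \<le> 1" if "0 \<le> s" "s < 1" for n s
  proof -
    have "h2_mean (\<lambda>z. z ^ n) s \<le> 1 + 0 * h2_mean (\<lambda>z. 0) s"
      by (rule h2_mean_le_circle) (use that in \<open>auto intro!: holomorphic_intros power_le_one simp: norm_power\<close>)
    then show ?thesis by simp
  qed
  have mono_H2: "(\<lambda>z. z ^ n) \<in> H2" for n
    using mean1 by (intro H2I[where B=1] holomorphic_intros) auto
  have "h2_norm (\<lambda>z. z ^ n) \<le> 1" for n
    using mean1 by (intro h2_norm_le) auto
  then obtain \<sigma> g where \<sigma>: "strict_mono \<sigma>" and g: "g \<in> H2"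
    and lim: "(\<lambda>n. h2_norm (\<lambda>z. wcomp w \<phi> (\<lambda>z. z ^ \<sigma> n) z - g z)) \<longlonglongrightarrow> 0"
    using cpt[unfolded compact_on_H2_def, rule_format, of "\<lambda>n z. z ^ n"] mono_H2 by auto
  define D where "D n z = w z * \<phi> z ^ \<sigma> n - g z" for n z
  define d where "d n = h2_norm (D n)" for n
  have d: "d \<longlonglongrightarrow> 0" using lim by (simp add: d_def[abs_def] D_def[abs_def] wcomp_def)
  have "\<forall>f\<in>H2. wcomp w \<phi> f \<in> H2" using bdd by (simp add: bounded_on_H2_def)
  then have "(\<lambda>z. w z * \<phi> z ^ \<sigma> n) \<in> H2" for n
    using bspec[OF _ mono_H2[of "\<sigma> n"]] by (simp add: wcomp_def)
  then have D_H2: "D n \<in> H2" for n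
    unfolding D_def by (intro H2_diff g)
  \<comment> \<open>Convergence in norm implies pointwise convergence by point evaluation, while the
    powers of \<phi> z tend to 0; hence the compactness limit vanishes.\<close>
  have g0: "g z = 0" if z: "cmod z < 1" for z
  proof -
    have "\<phi> z \<in> ball 0 1" using \<phi>(2) z by (auto simp: image_subset_iff)
    then have "(\<lambda>n. \<phi> z ^ n) \<longlonglongrightarrow> 0" by (intro LIMSEQ_power_zero) simp
    then have "(\<lambda>n. \<phi> z ^ \<sigma> n) \<longlonglongrightarrow> 0"
      using LIMSEQ_subseq_LIMSEQ[OF _ \<sigma>] by (fastforce simp: o_def)
    then have "(\<lambda>n. D n z) \<longlonglongrightarrow> w z * 0 - g z"
      unfolding D_def by (intro tendsto_intros)
    then have "(\<lambda>n. (cmod (D n z))\<^sup>2) \<longlonglongrightarrow> (cmod (w z * 0 - g z))\<^sup>2"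
      by (intro tendsto_intros)
    moreover have "(\<lambda>n. (1 + cmod z) / (1 - cmod z) * (d n)\<^sup>2) \<longlonglongrightarrow> (1 + cmod z) / (1 - cmod z) * 0\<^sup>2"
      by (intro tendsto_intros d)
    moreover have "(cmod (D n z))\<^sup>2 \<le> (1 + cmod z) / (1 - cmod z) * (d n)\<^sup>2" for n
      unfolding d_def by (intro h2_point_evaluation H2_holomorphic D_H2 h2_mean_le_norm z)
    ultimately have "(cmod (w z * 0 - g z))\<^sup>2 \<le> (1 + cmod z) / (1 - cmod z) * 0\<^sup>2"
      by (intro LIMSEQ_le) auto
    then show ?thesis by simp
  qed
  have V: "h2_mean (\<lambda>z. w z * \<phi> z ^ \<sigma> n) s \<le> (d n)\<^sup>2" if "0 \<le> s" "s < 1" for n s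
  proof -
    have "h2_mean (\<lambda>z. w z * \<phi> z ^ \<sigma> n) s = h2_mean (D n) s"
      by (rule h2_mean_cong) (use that g0 in \<open>auto simp: D_def\<close>)
    then show ?thesis using h2_mean_le_norm[OF D_H2 that] by (simp add: d_def)
  qed
  define W where "W = (h2_norm w)\<^sup>2"
  have W: "h2_mean w s \<le> W" if "0 \<le> s" "s < 1" for s
    unfolding W_def by (rule h2_mean_le_norm[OF w(1) that])
  obtain y where y: "cmod z0 < y" "y < 1" using w(2) dense[of "cmod z0" 1] by auto
  have y0: "0 < y" using y norm_ge_zero[of z0] by linarith
  define b where "b = (1 - y) / (1 + y) * e"
  have b: "0 < b" using y y0 \<open>0 < e\<close> by (simp add: b_def)
  define M where "M = (1 + y) / (1 - y) * (exp 1 * W)"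
  \<comment> \<open>The order of limits matters: for fixed K the term with exp K disappears as n
    grows, which leaves a bound M independent of K.\<close>
  have bound: "(cmod (w z0))\<^sup>2 * exp (K * b) \<le> M" if K: "0 \<le> K" for K
  proof -
    have "(cmod (w z0))\<^sup>2 * exp (K * b) \<le> (1 + y) / (1 - y) * (exp 1 * (W + exp K * (d n)\<^sup>2))" for n
    proof -
      obtain s0 where "0 \<le> s0" "s0 < 1" "e \<le> h2_mean (\<lambda>z. \<phi> z ^ \<sigma> n) s0" using large by blast
      then show ?thesis
        unfolding b_def using \<open>0 < e\<close>
        by (intro weight_lower_bound[OF \<phi> H2_holomorphic[OF w(1)] W V _ _ _ _ K y]) auto
    qed
    moreover have "(\<lambda>n. (1 + y) / (1 - y) * (exp 1 * (W + exp K * (d n)\<^sup>2)))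
        \<longlonglongrightarrow> (1 + y) / (1 - y) * (exp 1 * (W + exp K * 0\<^sup>2))"
      by (intro tendsto_intros d)
    ultimately have "(cmod (w z0))\<^sup>2 * exp (K * b) \<le> (1 + y) / (1 - y) * (exp 1 * (W + exp K * 0\<^sup>2))"
      by (intro LIMSEQ_le_const) auto
    then show ?thesis by (simp add: M_def)
  qed
  have w0: "0 < (cmod (w z0))\<^sup>2" using w(3) by simp
  have "0 \<le> M" using order_trans[OF zero_le_power2 bound[of 0, simplified]] by simp
  \<comment> \<open>Chosen so that already the linear part 1 + K b of the exponential, times |w
    z0|^2, equals |w z0|^2 + M and exceeds M.\<close>
  define K where "K = M / (cmod (w z0))\<^sup>2 / b"
  have K: "0 \<le> K" using \<open>0 \<le> M\<close> b by (simp add: K_def)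
  have "M < (cmod (w z0))\<^sup>2 * (1 + K * b)" using b w0 by (simp add: K_def distrib_left)
  also have "\<dots> \<le> (cmod (w z0))\<^sup>2 * exp (K * b)" using K b by (intro mult_left_mono exp_ge_add_one_self) auto
  finally show False using bound[OF K] by simp
qed

section \<open>Sufficiency\<close>

text \<open>The majorants are taken on smaller disks; Montel's theorem for the bounded functions
  \<open>exp (- \<Sum>\<^sub>j q\<^sub>j)\<close> then yields the weight without using boundary values of \<open>\<phi>\<close>.\<close>

lemma ex_weight_dominated:
  assumes \<phi>: "\<phi> holomorphic_on ball 0 1"
    and k: "\<And>j r. 0 \<le> r \<Longrightarrow> r < 1 \<Longrightarrow> h2_mean (\<lambda>z. \<phi> z ^ k j) r \<le> (1/2) ^ j"
  obtains w where "w holomorphic_on ball 0 1" "w 0 \<noteq> 0"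
    "\<And>z J. cmod z < 1 \<Longrightarrow> cmod (w z) \<le> exp (- (\<Sum>j<J. (cmod (\<phi> z ^ k j))\<^sup>2))"
proof -
  have \<phi>k: "(\<lambda>z. \<phi> z ^ k j) holomorphic_on ball 0 1" for j by (intro holomorphic_intros \<phi>)
  \<comment> \<open>The value at 0 is at most the mean, (1/2)^j, plus the tolerance of the majorant,
    again (1/2)^j.\<close>
  define P where "P j n q \<longleftrightarrow> (\<forall>z. cmod z \<le> 1 \<longrightarrow> (cmod (\<phi> (of_real (radii n) * z) ^ k j))\<^sup>2 \<le> Re (poly q z))
    \<and> Re (poly q 0) \<le> 2 * (1/2) ^ j" for j n q
  have "\<exists>q. P j n q" for j n
  proof -
    have r: "0 \<le> radii n" "radii n < 1" using radii_bounds[of n] by auto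
    obtain R where R: "1 < R" "(\<lambda>z. \<phi> (of_real (radii n) * z) ^ k j) holomorphic_on ball 0 R"
      using holomorphic_on_dilate[OF \<phi>k r] by blast
    have "(0::real) < (1/2) ^ j" by simp
    from holomorphic_square_poly_majorant[OF R(2,1) this]
    obtain q where q: "\<And>z. cmod z \<le> 1 \<Longrightarrow> (cmod (\<phi> (of_real (radii n) * z) ^ k j))\<^sup>2 \<le> Re (poly q z)"
      "\<And>z. cmod z = 1 \<Longrightarrow> Re (poly q z) \<le> (cmod (\<phi> (of_real (radii n) * z) ^ k j))\<^sup>2 + (1/2) ^ j"
      by metis
    have cont: "continuous_on (sphere 0 1) (\<lambda>z. \<phi> (of_real (radii n) * z) ^ k j)"
      by (rule continuous_on_dilate[OF \<phi>k r]) auto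
    have "Re (poly q 0) \<le> circle_mean (\<lambda>z. (cmod (\<phi> (of_real (radii n) * z) ^ k j))\<^sup>2 + (1/2) ^ j)"
      unfolding circle_mean_Re_poly[symmetric]
      by (intro circle_mean_mono continuous_on_add continuous_on_power continuous_on_norm cont continuous_intros q(2))
    also have "\<dots> = h2_mean (\<lambda>z. \<phi> z ^ k j) (radii n) + (1/2) ^ j"
      unfolding h2_mean_eq[OF \<phi>k r]
      by (subst circle_mean_add) (auto intro!: continuous_on_power continuous_on_norm cont)
    also have "\<dots> \<le> 2 * (1/2) ^ j" using k[OF r, of j] by simp
    finally show ?thesis using q(1) unfolding P_def by blast
  qed
  then obtain q where "\<And>j n. P j n (q j n)" by metis
  then have q: "\<And>j n z. cmod z \<le> 1 \<Longrightarrow> (cmod (\<phi> (of_real (radii n) * z) ^ k j))\<^sup>2 \<le> Re (poly (q j n) z)"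
    and q0: "\<And>j n. Re (poly (q j n) 0) \<le> 2 * (1/2) ^ j"
    unfolding P_def by blast+
  \<comment> \<open>The number of summands and the dilation radius grow together; the domination by
    the first J terms holds from n = J on and survives the limit.\<close>
  define v where "v n z = exp (- (\<Sum>j<n. poly (q j n) z))" for n z
  have cmod_v: "cmod (v n z) = exp (- (\<Sum>j<n. Re (poly (q j n) z)))" for n z
    by (simp add: v_def)
  have v_le: "cmod (v n z) \<le> exp (- (\<Sum>j<J. (cmod (\<phi> (of_real (radii n) * z) ^ k j))\<^sup>2))"
    if z: "cmod z < 1" and J: "J \<le> n" for n z J
  proof -
    have "(\<Sum>j<J. (cmod (\<phi> (of_real (radii n) * z) ^ k j))\<^sup>2) \<le> (\<Sum>j<n. (cmod (\<phi> (of_real (radii n) * z) ^ k j))\<^sup>2)"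
      using J by (intro sum_mono2) auto
    also have "\<dots> \<le> (\<Sum>j<n. Re (poly (q j n) z))"
      using z by (intro sum_mono q) auto
    finally show ?thesis unfolding cmod_v by simp
  qed
  have v1: "cmod (v n z) \<le> 1" if "cmod z < 1" for n z
    using v_le[OF that, of 0 n] by simp
  \<comment> \<open>The values at 0 sum to at most 4 over all j. This uniform lower bound makes the
    Montel limit nonzero.\<close>
  have v0: "exp (- 4) \<le> cmod (v n 0)" for n
  proof -
    have "(\<Sum>j<n. Re (poly (q j n) 0)) \<le> (\<Sum>j<n. 2 * (1/2) ^ j)" by (intro sum_mono q0)
    also have "\<dots> = 2 * (\<Sum>j<n. (1/2) ^ j)" by (simp add: sum_distrib_left)
    also have "(\<Sum>j<n. (1/2::real) ^ j) \<le> 2" by (simp add: sum_gp_strict)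
    finally show ?thesis unfolding cmod_v by simp
  qed
  obtain w r where w: "w holomorphic_on ball 0 1" "strict_mono r" "\<And>z. z \<in> ball 0 1 \<Longrightarrow> (\<lambda>n. v (r n) z) \<longlonglongrightarrow> w z"
  proof (rule Montel[of "ball 0 1" "range v" v])
    show "h holomorphic_on ball 0 1" if "h \<in> range v" for h
      using that unfolding v_def by (auto intro!: holomorphic_intros)
    show "\<exists>B. \<forall>h\<in>range v. \<forall>z\<in>K. cmod (h z) \<le> B" if "compact K" "K \<subseteq> ball 0 1" for K
      using that v1 by (intro exI[of _ 1]) auto
  qed auto
  show thesis
  proof (rule that[OF w(1)])
    have "(\<lambda>n. cmod (v (r n) 0)) \<longlonglongrightarrow> cmod (w 0)" by (intro tendsto_intros w(3)) auto
    then have "exp (- 4) \<le> cmod (w 0)" by (rule LIMSEQ_le_const) (use v0 in auto)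
    then have "0 < cmod (w 0)" using exp_gt_zero[of "- 4 :: real"] by linarith
    then show "w 0 \<noteq> 0" by auto
    fix z J assume z: "cmod z < 1"
    have r: "filterlim r at_top sequentially" using w(2) by (rule filterlim_subseq)
    have "(\<lambda>n. radii (r n)) \<longlonglongrightarrow> 1"
      by (rule filterlim_compose[OF radii_tendsto r])
    then have "(\<lambda>n. of_real (radii (r n)) * z) \<longlonglongrightarrow> of_real 1 * z" by (intro tendsto_intros)
    moreover have "isCont \<phi> z"
      using holomorphic_on_imp_continuous_on[OF \<phi>] z by (simp add: continuous_on_eq_continuous_at)
    ultimately have lim: "(\<lambda>n. \<phi> (of_real (radii (r n)) * z)) \<longlonglongrightarrow> \<phi> z"
      using isCont_tendsto_compose by force
    have "(\<lambda>n. cmod (v (r n) z)) \<longlonglongrightarrow> cmod (w z)" using z by (intro tendsto_intros w(3)) auto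
    moreover have "(\<lambda>n. exp (- (\<Sum>j<J. (cmod (\<phi> (of_real (radii (r n)) * z) ^ k j))\<^sup>2)))
        \<longlonglongrightarrow> exp (- (\<Sum>j<J. (cmod (\<phi> z ^ k j))\<^sup>2))"
      by (intro tendsto_intros lim)
    moreover have "eventually (\<lambda>n. cmod (v (r n) z) \<le> exp (- (\<Sum>j<J. (cmod (\<phi> (of_real (radii (r n)) * z) ^ k j))\<^sup>2))) sequentially"
      using filterlim_at_top[THEN iffD1, OF r, rule_format, of J]
      by eventually_elim (rule v_le[OF z])
    ultimately show "cmod (w z) \<le> exp (- (\<Sum>j<J. (cmod (\<phi> z ^ k j))\<^sup>2))"
      by (intro tendsto_le[OF sequentially_bot])
  qed
qed

text \<open>The sum in the exponent is a function of |\<phi> z| alone, and its first J terms tend to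
  J as that modulus tends to 1. The smallness is therefore uniform in z.\<close>

lemma ex_weight_vanishing:
  assumes \<phi>: "\<phi> holomorphic_on ball 0 1" "\<phi> ` ball 0 1 \<subseteq> ball 0 1"
    and vanish: "\<And>e. 0 < e \<Longrightarrow> \<exists>k. \<forall>r. 0 \<le> r \<longrightarrow> r < 1 \<longrightarrow> h2_mean (\<lambda>z. \<phi> z ^ k) r \<le> e"
  obtains w where "w holomorphic_on ball 0 1" "w 0 \<noteq> 0" "\<And>z. cmod z < 1 \<Longrightarrow> cmod (w z) \<le> 1"
    "\<And>\<eta>. 0 < \<eta> \<Longrightarrow> \<exists>\<rho><1. \<forall>z. cmod z < 1 \<longrightarrow> \<rho> < cmod (\<phi> z) \<longrightarrow> cmod (w z) \<le> \<eta>"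
proof -
  have "\<exists>k. \<forall>r. 0 \<le> r \<longrightarrow> r < 1 \<longrightarrow> h2_mean (\<lambda>z. \<phi> z ^ k) r \<le> (1/2) ^ j" for j
    by (rule vanish) simp
  then obtain k where k: "\<And>j r. 0 \<le> r \<Longrightarrow> r < 1 \<Longrightarrow> h2_mean (\<lambda>z. \<phi> z ^ k j) r \<le> (1/2) ^ j"
    by metis
  obtain w where w: "w holomorphic_on ball 0 1" "w 0 \<noteq> 0"
    "\<And>z J. cmod z < 1 \<Longrightarrow> cmod (w z) \<le> exp (- (\<Sum>j<J. (cmod (\<phi> z ^ k j))\<^sup>2))"
    using ex_weight_dominated[OF \<phi>(1) k] by blast
  show thesis
  proof (rule that[OF w(1,2)])
    show "cmod (w z) \<le> 1" if "cmod z < 1" for z using w(3)[OF that, of 0] by simp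
    fix \<eta> :: real assume "0 < \<eta>"
    \<comment> \<open>J terms close to 1 push the bound exp (- J) below \<eta>.\<close>
    obtain J :: nat where J: "- ln \<eta> < real J" using reals_Archimedean2 by blast
    have "((\<lambda>x. \<Sum>j<J. (x ^ k j)\<^sup>2) \<longlongrightarrow> (\<Sum>j<J. (1 ^ k j)\<^sup>2)) (at_left (1::real))"
      by (intro tendsto_intros)
    then have lim: "((\<lambda>x. \<Sum>j<J. (x ^ k j)\<^sup>2) \<longlongrightarrow> real J) (at_left (1::real))" by simp
    have "eventually (\<lambda>x. - ln \<eta> < (\<Sum>j<J. (x ^ k j)\<^sup>2)) (at_left (1::real))"
      by (rule order_tendstoD(1)[OF lim J])
    then obtain \<rho> where \<rho>: "\<rho> < 1" "\<And>x. \<rho> < x \<Longrightarrow> x < 1 \<Longrightarrow> - ln \<eta> < (\<Sum>j<J. (x ^ k j)\<^sup>2)"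
      unfolding eventually_at_left_field by auto
    show "\<exists>\<rho><1. \<forall>z. cmod z < 1 \<longrightarrow> \<rho> < cmod (\<phi> z) \<longrightarrow> cmod (w z) \<le> \<eta>"
    proof (intro exI[of _ \<rho>] conjI allI impI \<rho>(1))
      fix z assume z: "cmod z < 1" "\<rho> < cmod (\<phi> z)"
      have "cmod (\<phi> z) < 1" using \<phi>(2) z by (auto simp: image_subset_iff)
      then have "- ln \<eta> < (\<Sum>j<J. (cmod (\<phi> z ^ k j))\<^sup>2)"
        using \<rho>(2)[OF z(2)] by (simp add: norm_power)
      then have "exp (- (\<Sum>j<J. (cmod (\<phi> z ^ k j))\<^sup>2)) \<le> exp (ln \<eta>)" by simp
      then show "cmod (w z) \<le> \<eta>" using w(3)[OF z(1), of J] \<open>0 < \<eta>\<close> by simp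
    qed
  qed
qed

section \<open>Boundedness and compactness of the weighted operator\<close>

lemma wcomp_bounded:
  assumes \<phi>: "\<phi> holomorphic_on ball 0 1" "\<phi> ` ball 0 1 \<subseteq> ball 0 1"
    and w: "w holomorphic_on ball 0 1" "\<And>z. cmod z < 1 \<Longrightarrow> cmod (w z) \<le> 1"
    and f: "f \<in> H2"
  defines "C \<equiv> (1 + cmod (\<phi> 0)) / (1 - cmod (\<phi> 0))"
  shows "wcomp w \<phi> f \<in> H2" "h2_norm (wcomp w \<phi> f) \<le> sqrt C * h2_norm f"
proof -
  note f' = H2_holomorphic[OF f]
  have "cmod (\<phi> 0) < 1" using \<phi>(2) by (auto simp: image_subset_iff)
  then have C: "0 \<le> C" by (simp add: C_def)
  have f\<phi>: "(\<lambda>z. f (\<phi> z)) holomorphic_on ball 0 1"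
    using holomorphic_on_compose_gen[OF \<phi>(1) f' \<phi>(2)] by (simp add: o_def)
  have hol: "wcomp w \<phi> f holomorphic_on ball 0 1"
    unfolding wcomp_def by (intro holomorphic_intros w f\<phi>)
  have mean: "h2_mean (wcomp w \<phi> f) s \<le> C * (h2_norm f)\<^sup>2" if s: "0 \<le> s" "s < 1" for s
  proof -
    have "h2_mean (wcomp w \<phi> f) s \<le> 0 + 1 * h2_mean (\<lambda>z. f (\<phi> z)) s"
    proof (rule h2_mean_le_circle[OF hol f\<phi> s])
      fix z :: complex assume "cmod z < 1"
      then have "(cmod (w z))\<^sup>2 * (cmod (f (\<phi> z)))\<^sup>2 \<le> 1 * (cmod (f (\<phi> z)))\<^sup>2"
        using w(2) by (intro mult_right_mono power_le_one) auto
      then show "(cmod (wcomp w \<phi> f z))\<^sup>2 \<le> 0 + 1 * (cmod (f (\<phi> z)))\<^sup>2"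
        by (simp add: wcomp_def norm_mult power_mult_distrib)
    qed
    also have "\<dots> \<le> C * (h2_norm f)\<^sup>2"
      using littlewood_subordination[OF f' h2_mean_le_norm[OF f] \<phi> s] by (simp add: C_def)
    finally show ?thesis .
  qed
  show "wcomp w \<phi> f \<in> H2" by (rule H2I[OF hol mean])
  show "h2_norm (wcomp w \<phi> f) \<le> sqrt C * h2_norm f"
    using mean C h2_norm_nonneg[OF f] by (intro h2_norm_le) (auto simp: power_mult_distrib)
qed

text \<open>Point evaluation bounds the unit ball locally uniformly, so Montel applies. The limit
  stays in the ball because each circle of radius s < 1 is compact in the disk and the means
  converge there.\<close>

lemma H2_ball_montel:
  assumes f: "\<And>n. f n \<in> H2" "\<And>n. h2_norm (f n) \<le> 1"
  obtains g r where "g \<in> H2" "h2_norm g \<le> 1" "strict_mono (r :: nat \<Rightarrow> nat)"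
    "\<And>K. compact K \<Longrightarrow> K \<subseteq> ball 0 1 \<Longrightarrow> uniform_limit K (\<lambda>n. f (r n)) g sequentially"
proof -
  have hol: "f n holomorphic_on ball 0 1" for n by (rule H2_holomorphic[OF f(1)])
  have mean: "h2_mean (f n) s \<le> 1" if "0 \<le> s" "s < 1" for n s
    using h2_mean_le_norm[OF f(1) that, of n] f(2)[of n] h2_norm_nonneg[OF f(1), of n]
      power_le_one[of "h2_norm (f n)" 2] by linarith
  obtain g r where g: "g holomorphic_on ball 0 1" "strict_mono r"
    "\<And>K. compact K \<Longrightarrow> K \<subseteq> ball 0 1 \<Longrightarrow> uniform_limit K (f \<circ> r) g sequentially"
  proof (rule Montel[of "ball 0 1" "range f" f])
    show "h holomorphic_on ball 0 1" if "h \<in> range f" for h using that hol by auto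
    show "\<exists>B. \<forall>h\<in>range f. \<forall>z\<in>K. cmod (h z) \<le> B" if K: "compact K" "K \<subseteq> ball 0 1" for K
    proof -
      have "continuous_on K (\<lambda>z. sqrt ((1 + cmod z) / (1 - cmod z)))"
        using K(2) by (intro continuous_intros) auto
      then have "bounded ((\<lambda>z. sqrt ((1 + cmod z) / (1 - cmod z))) ` K)"
        using K(1) by (intro compact_imp_bounded compact_continuous_image)
      then obtain B where B: "\<And>z. z \<in> K \<Longrightarrow> \<bar>sqrt ((1 + cmod z) / (1 - cmod z))\<bar> \<le> B"
        by (auto simp: bounded_iff)
      have "cmod (f n z) \<le> B" if z: "z \<in> K" for n z
      proof -
        have "(cmod (f n z))\<^sup>2 \<le> (1 + cmod z) / (1 - cmod z) * 1"
          by (rule h2_point_evaluation[OF hol mean]) (use z K in auto)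
        then have "cmod (f n z) \<le> sqrt ((1 + cmod z) / (1 - cmod z))"
          by (intro real_le_rsqrt) simp
        then show ?thesis using B[OF z] by linarith
      qed
      then show ?thesis by blast
    qed
  qed auto
  have unif: "uniform_limit K (\<lambda>n. f (r n)) g sequentially" if "compact K" "K \<subseteq> ball 0 1" for K
    using g(3)[OF that] by (simp add: o_def)
  have gmean: "h2_mean g s \<le> 1" if s: "0 \<le> s" "s < 1" for s
  proof -
    have "uniform_limit (cball 0 s) (\<lambda>n. f (r n)) g sequentially" using s by (intro unif) auto
    then have "uniform_limit (sphere 0 1) (\<lambda>n z. f (r n) (of_real s * z)) (\<lambda>z. g (of_real s * z)) sequentially"
      by (rule uniform_limit_compose') (use s in \<open>auto simp: norm_mult\<close>)
    then have "(\<lambda>n. h2_mean (f (r n)) s) \<longlonglongrightarrow> h2_mean g s"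
      unfolding h2_mean_eq[OF hol s] h2_mean_eq[OF g(1) s]
      by (intro circle_mean_square_tendsto continuous_on_dilate hol g s) auto
    then show ?thesis by (rule LIMSEQ_le_const2) (use mean[OF s] in auto)
  qed
  show thesis
  proof (rule that[OF _ _ g(2) unif])
    show "g \<in> H2" by (rule H2I[OF g(1) gmean])
    show "h2_norm g \<le> 1" by (rule h2_norm_le) (use gmean in auto)
  qed
qed

text \<open>Where |\<phi>| > \<rho> the weight is small and Littlewood subordination controls the
  rest; elsewhere \<phi> z lies in a compact disk on which the subsequence converges
  uniformly.\<close>

lemma wcomp_compact:
  assumes \<phi>: "\<phi> holomorphic_on ball 0 1" "\<phi> ` ball 0 1 \<subseteq> ball 0 1"
    and w: "w holomorphic_on ball 0 1" "\<And>z. cmod z < 1 \<Longrightarrow> cmod (w z) \<le> 1"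
    and small: "\<And>\<eta>. 0 < \<eta> \<Longrightarrow> \<exists>\<rho><1. \<forall>z. cmod z < 1 \<longrightarrow> \<rho> < cmod (\<phi> z) \<longrightarrow> cmod (w z) \<le> \<eta>"
  shows "compact_on_H2 (wcomp w \<phi>)"
  unfolding compact_on_H2_def
proof (intro allI impI)
  fix f :: "nat \<Rightarrow> complex \<Rightarrow> complex"
  assume "\<forall>n. f n \<in> H2 \<and> h2_norm (f n) \<le> 1"
  then have f: "f n \<in> H2" "h2_norm (f n) \<le> 1" for n by auto
  obtain g r where g: "g \<in> H2" "h2_norm g \<le> 1" and r: "strict_mono r"
    and unif: "\<And>K. compact K \<Longrightarrow> K \<subseteq> ball 0 1 \<Longrightarrow> uniform_limit K (\<lambda>n. f (r n)) g sequentially"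
    by (rule H2_ball_montel[of f, OF f]) (rule that)
  define F where "F n z = f (r n) z - g z" for n z
  \<comment> \<open>The factor 4 bounds the means of a difference of two elements of the unit ball,
    2 + 2; the quotient is the subordination constant.\<close>
  define C where "C = (1 + cmod (\<phi> 0)) / (1 - cmod (\<phi> 0)) * 4"
  have \<phi>1: "cmod (\<phi> z) < 1" if "cmod z < 1" for z using \<phi>(2) that by (auto simp: image_subset_iff)
  have "0 \<le> C" using \<phi>1[of 0] by (simp add: C_def)
  have hol: "F n holomorphic_on ball 0 1" for n
    unfolding F_def by (intro holomorphic_intros H2_holomorphic f g)
  have F4: "h2_mean (F n) s \<le> 4" if s: "0 \<le> s" "s < 1" for n s
  proof -
    have le1: "h2_mean h s \<le> 1" if "h \<in> H2" "h2_norm h \<le> 1" for h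
      using h2_mean_le_norm[OF that(1) s] power_le_one[OF h2_norm_nonneg[OF that(1)] that(2), of 2] by linarith
    have "h2_mean (F n) s \<le> 2 * h2_mean (f (r n)) s + 2 * h2_mean g s"
      unfolding F_def by (intro h2_mean_diff_le H2_holomorphic f g s)
    then show ?thesis using le1[OF f, of "r n"] le1[OF g] by linarith
  qed
  have F\<phi>: "(\<lambda>z. F n (\<phi> z)) holomorphic_on ball 0 1" for n
    using holomorphic_on_compose_gen[OF \<phi>(1) hol \<phi>(2)] by (simp add: o_def)
  have wF: "(\<lambda>z. w z * F n (\<phi> z)) holomorphic_on ball 0 1" for n
    by (intro holomorphic_intros w F\<phi>)
  have ev: "eventually (\<lambda>n. h2_norm (\<lambda>z. w z * F n (\<phi> z)) \<le> \<eta> * sqrt (1 + C)) sequentially" if \<eta>: "0 < \<eta>" for \<eta>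
  proof -
    obtain \<rho> where \<rho>: "\<rho> < 1" "\<And>z. cmod z < 1 \<Longrightarrow> \<rho> < cmod (\<phi> z) \<Longrightarrow> cmod (w z) \<le> \<eta>"
      using small[OF \<eta>] by blast
    have "uniform_limit (cball 0 \<rho>) (\<lambda>n. f (r n)) g sequentially"
      using \<rho> by (intro unif) auto
    from uniform_limitD[OF this \<eta>]
    show ?thesis
    proof eventually_elim
      case (elim n)
      show ?case
      proof (rule h2_norm_le)
        fix s :: real assume s: "0 \<le> s" "s < 1"
        have "h2_mean (\<lambda>z. w z * F n (\<phi> z)) s \<le> \<eta>\<^sup>2 + \<eta>\<^sup>2 * h2_mean (\<lambda>z. F n (\<phi> z)) s"
        proof (rule h2_mean_le_circle[OF wF F\<phi> s])
          fix z :: complex assume z: "cmod z < 1"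
          have "(cmod (w z * F n (\<phi> z)))\<^sup>2 = (cmod (w z))\<^sup>2 * (cmod (F n (\<phi> z)))\<^sup>2"
            by (simp add: norm_mult power_mult_distrib)
          \<comment> \<open>One affine bound serves both regions: the second term handles |\<phi> z|
            > \<rho>, the first the compact disk, where |w| \<le> 1.\<close>
          also have "\<dots> \<le> \<eta>\<^sup>2 + \<eta>\<^sup>2 * (cmod (F n (\<phi> z)))\<^sup>2"
          proof (cases "\<rho> < cmod (\<phi> z)")
            case True
            then have "(cmod (w z))\<^sup>2 * (cmod (F n (\<phi> z)))\<^sup>2 \<le> \<eta>\<^sup>2 * (cmod (F n (\<phi> z)))\<^sup>2"
              using \<rho>(2)[OF z] by (intro mult_right_mono power_mono) auto
            then show ?thesis using zero_le_power2[of \<eta>] by linarith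
          next
            case False
            then have "\<phi> z \<in> cball 0 \<rho>" by simp
            then have "cmod (F n (\<phi> z)) \<le> \<eta>" using bspec[OF elim] by (simp add: F_def dist_norm less_imp_le)
            then have "(cmod (w z))\<^sup>2 * (cmod (F n (\<phi> z)))\<^sup>2 \<le> 1 * \<eta>\<^sup>2"
              using w(2)[OF z] by (intro mult_mono power_mono power_le_one) auto
            moreover have "0 \<le> \<eta>\<^sup>2 * (cmod (F n (\<phi> z)))\<^sup>2" by simp
            ultimately show ?thesis by linarith
          qed
          finally show "(cmod (w z * F n (\<phi> z)))\<^sup>2 \<le> \<eta>\<^sup>2 + \<eta>\<^sup>2 * (cmod (F n (\<phi> z)))\<^sup>2" .
        qed
        also have "\<dots> \<le> \<eta>\<^sup>2 + \<eta>\<^sup>2 * C"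
          using littlewood_subordination[OF hol F4 \<phi> s] by (intro add_left_mono mult_left_mono) (auto simp: C_def)
        also have "\<dots> = (\<eta> * sqrt (1 + C))\<^sup>2"
          using \<open>0 \<le> C\<close> by (simp add: power_mult_distrib distrib_left)
        finally show "h2_mean (\<lambda>z. w z * F n (\<phi> z)) s \<le> (\<eta> * sqrt (1 + C))\<^sup>2" .
      qed (use \<eta> \<open>0 \<le> C\<close> in auto)
    qed
  qed
  have "(\<lambda>n. h2_norm (\<lambda>z. w z * F n (\<phi> z))) \<longlonglongrightarrow> 0"
  proof (rule tendstoI)
    fix e :: real assume "0 < e"
    define \<eta> where "\<eta> = e / 2 / sqrt (1 + C)"
    have sq: "0 < sqrt (1 + C)" using \<open>0 \<le> C\<close> by simp
    have \<eta>: "0 < \<eta>" using \<open>0 < e\<close> sq by (simp add: \<eta>_def)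
    have \<eta>e: "\<eta> * sqrt (1 + C) = e / 2" unfolding \<eta>_def using sq by simp
    have "0 \<le> h2_norm (\<lambda>z. w z * F n (\<phi> z))" for n
    proof (rule h2_norm_nonneg)
      have "F n \<in> H2" by (rule H2I[OF hol F4])
      from wcomp_bounded(1)[OF \<phi> w this] show "(\<lambda>z. w z * F n (\<phi> z)) \<in> H2" by (simp add: wcomp_def)
    qed
    then show "\<forall>\<^sub>F n in sequentially. dist (h2_norm (\<lambda>z. w z * F n (\<phi> z))) 0 < e"
      using ev[OF \<eta>] \<open>0 < e\<close> unfolding \<eta>e by (auto elim!: eventually_mono)
  qed
  then have "(\<lambda>n. h2_norm (\<lambda>z. wcomp w \<phi> (f (r n)) z - wcomp w \<phi> g z)) \<longlonglongrightarrow> 0"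
    by (simp add: wcomp_def F_def right_diff_distrib)
  then show "\<exists>\<sigma> h. strict_mono \<sigma> \<and> h \<in> H2 \<and> (\<lambda>n. h2_norm (\<lambda>z. wcomp w \<phi> (f (\<sigma> n)) z - h z)) \<longlonglongrightarrow> 0"
    using r wcomp_bounded(1)[OF \<phi> w g(1)] by blast
qed

text \<open>The circle is parametrised by the angle over one closed period, so the \<open>AE\<close>
  statement expresses measure zero on the circle. That w is not identically zero is asked at a point
  of the disk, since values of the total function outside it carry no meaning.\<close>

theorem theorem3p1:
  fixes \<phi> :: "complex \<Rightarrow> complex"
  assumes "\<phi> holomorphic_on ball 0 1"
      and "\<phi> ` ball 0 1 \<subseteq> ball 0 1"
  shows "(\<exists>w\<in>H2. (\<exists>z\<in>ball 0 1. w z \<noteq> 0) \<and>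
            bounded_on_H2 (wcomp w \<phi>) \<and> compact_on_H2 (wcomp w \<phi>))
         \<longleftrightarrow> (AE t in lborel. t \<in> {0..2*pi} \<longrightarrow> \<not> radial_unimodular \<phi> t)"
proof
  assume "\<exists>w\<in>H2. (\<exists>z\<in>ball 0 1. w z \<noteq> 0) \<and> bounded_on_H2 (wcomp w \<phi>) \<and> compact_on_H2 (wcomp w \<phi>)"
  then obtain w z0 where w: "w \<in> H2" "z0 \<in> ball 0 1" "w z0 \<noteq> 0"
    "bounded_on_H2 (wcomp w \<phi>)" "compact_on_H2 (wcomp w \<phi>)" by blast
  show "AE t in lborel. t \<in> {0..2*pi} \<longrightarrow> \<not> radial_unimodular \<phi> t"
    by (rule power_means_vanish_imp_AE[OF assms(1) compact_weighted_imp_power_means_vanish[OF assms w]])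
next
  assume ae: "AE t in lborel. t \<in> {0..2*pi} \<longrightarrow> \<not> radial_unimodular \<phi> t"
  obtain w where w: "w holomorphic_on ball 0 1" "w 0 \<noteq> 0" "\<And>z. cmod z < 1 \<Longrightarrow> cmod (w z) \<le> 1"
    "\<And>\<eta>. 0 < \<eta> \<Longrightarrow> \<exists>\<rho><1. \<forall>z. cmod z < 1 \<longrightarrow> \<rho> < cmod (\<phi> z) \<longrightarrow> cmod (w z) \<le> \<eta>"
    using ex_weight_vanishing[OF assms AE_imp_power_means_vanish[OF assms ae]] by blast
  have "h2_mean w s \<le> 1" if "0 \<le> s" "s < 1" for s
  proof -
    have "h2_mean w s \<le> 1 + 0 * h2_mean w s"
      by (rule h2_mean_le_circle[OF w(1) w(1) that]) (use w(3) in \<open>auto intro!: power_le_one\<close>)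
    then show ?thesis by simp
  qed
  then have "w \<in> H2" by (rule H2I[OF w(1)])
  moreover have "bounded_on_H2 (wcomp w \<phi>)"
    unfolding bounded_on_H2_def using wcomp_bounded[OF assms w(1,3)] by blast
  moreover have "compact_on_H2 (wcomp w \<phi>)"
    by (rule wcomp_compact[OF assms w(1,3,4)])
  moreover have "\<exists>z\<in>ball 0 1. w z \<noteq> 0" using w(2) by (intro bexI[of _ 0]) auto
  ultimately show "\<exists>w\<in>H2. (\<exists>z\<in>ball 0 1. w z \<noteq> 0) \<and>
      bounded_on_H2 (wcomp w \<phi>) \<and> compact_on_H2 (wcomp w \<phi>)" by blast
qed

end
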